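(* Let $T$ be a tournament. Then $T\in\mathcal{D}_5\setminus\mathcal{D}_3$ if and only if $T$ is switching equivalent to a transitive blowup of $L_6$.
   Context: A tournament is a directed graph with exactly one arc between each pair of distinct vertices; $u\rightarrow v$ means the arc goes from $u$ to $v$. For a tournament $T$ on vertices $v_1,\dots,v_n$, its skew-adjacency matrix is the $n\times n$ zero-diagonal matrix $S_T=[s_{ij}]$ with $s_{ij}=-s_{ji}=1$ if $v_i\rightarrow v_j$, and $\det(T):=\det(S_T)$. A subtournament of $T$ is the tournament $T[X]$ induced by a nonempty subset $X\subseteq V(T)$ (including $T$ itself). For a positive odd integer $k$, $\mathcal{D}_k$ is the set of tournaments all of whose subtournaments have determinant at most $k^2$. A tournament is transitive if it contains no directed 3-cycle. The switch of $T$ with respect to $W\subseteq V(T)$ is obtained by reversing all arcs between $W$ and $V(T)\setminus W$; two tournaments are switching equivalent if one is a switch of the other. For an $n$-tournament $R$ with vertices $v_1,\dots,v_n$ and positive integers $a_1,\dots,a_n$, the transitive blowup $R(a_1,\dots,a_n)$ is obtained by replacing each $v_i$ with a transitive tournament $T_i$ on $a_i$ vertices and putting $V(T_i)\rightarrow V(T_j)$ (all arcs from $V(T_i)$ to $V(T_j)$) whenever $v_i\rightarrow v_j$ in $R$. For $n\ge 2$, $L_n$ is the tournament on vertices $u_1,\dots,u_n$ with $u_i\rightarrow u_j$ for $1\le i<j\le n-1$, and for $1\le i\le n-1$: $u_n\rightarrow u_i$ if $i$ is odd and $u_i\rightarrow u_n$ if $i$ is even. A tournament "is $L_n$" if it is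 isomorphic to $L_n$. *)

theory Defs
  imports "Graph_Theory.Graph_Theory" "Jordan_Normal_Form.Determinant"
begin

definition tournament :: "'a pair_pre_digraph \<Rightarrow> bool" where
  "tournament T \<longleftrightarrow> pair_digraph T \<and>
     (\<forall>u\<in>pverts T. \<forall>v\<in>pverts T. u \<noteq> v \<longrightarrow> ((u, v) \<in> parcs T \<longleftrightarrow> (v, u) \<notin> parcs T))"

definition subtournament :: "'a pair_pre_digraph \<Rightarrow> 'a set \<Rightarrow> 'a pair_pre_digraph" where
  "subtournament T X = \<lparr>pverts = X, parcs = parcs T \<inter> X \<times> X\<rparr>"

lemma with_proj_subtournament:
  "with_proj (subtournament T X) = with_proj T \<restriction> X"
  by (auto simp: with_proj_def subtournament_def induce_subgraph_def)

lemma tournament_subtournament: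
  assumes "tournament T" "X \<subseteq> pverts T"
  shows "tournament (subtournament T X)"
proof -
  interpret pair_digraph T using assms(1) by (simp add: tournament_def)
  have "pair_digraph (subtournament T X)"
    using assms(2) pair_finite_verts pair_no_loops
    by unfold_locales (auto simp: subtournament_def dest: finite_subset)
  then show ?thesis
    using assms by (auto simp: tournament_def subtournament_def)
qed

definition skew_adjacency_mat :: "'a pair_pre_digraph \<Rightarrow> 'a list \<Rightarrow> int mat" where
  "skew_adjacency_mat T vs = mat (length vs) (length vs)
     (\<lambda>(i, j). if (vs ! i, vs ! j) \<in> parcs T then 1
              else if (vs ! j, vs ! i) \<in> parcs T then - 1 else 0)"

text \<open>The enumeration of the vertices is immaterial, see \<open>tournament_det_eq\<close> below.\<close>

definition tournament_det :: "'a pair_pre_digraph \<Rightarrow> int" where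
  "tournament_det T = det (skew_adjacency_mat T (SOME vs. distinct vs \<and> set vs = pverts T))"

lemma det_skew_adjacency_mat_permute:
  assumes p: "p permutes {..<length vs}"
  shows "det (skew_adjacency_mat T (permute_list p vs)) = det (skew_adjacency_mat T vs)"
proof -
  let ?n = "length vs"
  let ?A = "skew_adjacency_mat T vs"
  have p': "p permutes {0..<?n}" using p by (simp add: atLeast0LessThan)
  have A: "?A \<in> carrier_mat ?n ?n" by (simp add: skew_adjacency_mat_def)
  define B where "B = mat ?n ?n (\<lambda>(i, j). ?A $$ (p i, j))"
  have B: "B \<in> carrier_mat ?n ?n" by (simp add: B_def)
  have lt: "p i < ?n" if "i < ?n" for i using permutes_in_image[OF p, of i] that by simp
  have "skew_adjacency_mat T (permute_list p vs) =
      transpose_mat (mat ?n ?n (\<lambda>(i, j). transpose_mat B $$ (p i, j)))"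
    by (rule eq_matI) (auto simp: skew_adjacency_mat_def B_def permute_list_nth[OF p] lt)
  then have "det (skew_adjacency_mat T (permute_list p vs)) =
      det (mat ?n ?n (\<lambda>(i, j). transpose_mat B $$ (p i, j)))"
    by (simp add: det_transpose[of _ ?n])
  also have "\<dots> = signof p * det (transpose_mat B)"
    by (rule det_permute_rows[OF _ p']) (use B in simp)
  also have "\<dots> = signof p * det B"
    using B by (simp add: det_transpose[of _ ?n])
  also have "\<dots> = signof p * (signof p * det ?A)"
    unfolding B_def by (subst det_permute_rows[OF A p']) simp
  also have "\<dots> = det ?A"
    by (simp add: sign_def)
  finally show ?thesis .
qed

lemma tournament_det_eq:
  assumes "distinct vs" "set vs = pverts T"
  shows "tournament_det T = det (skew_adjacency_mat T vs)"
proof -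
  define ws where "ws = (SOME vs. distinct vs \<and> set vs = pverts T)"
  have "distinct ws \<and> set ws = pverts T"
    unfolding ws_def by (rule someI_ex) (use assms in blast)
  then have "mset ws = mset vs"
    using assms set_eq_iff_mset_eq_distinct[of ws vs] by simp
  then obtain p where "p permutes {..<length vs}" "permute_list p vs = ws"
    by (rule mset_eq_permutation)
  then show ?thesis
    using det_skew_adjacency_mat_permute[of p vs T]
    by (simp add: tournament_det_def flip: ws_def)
qed

definition D_class :: "nat \<Rightarrow> 'a pair_pre_digraph set" where
  "D_class k = {T. tournament T \<and>
     (\<forall>X. X \<noteq> {} \<longrightarrow> X \<subseteq> pverts T \<longrightarrow> tournament_det (subtournament T X) \<le> (int k)\<^sup>2)}"

definition transitive_tournament :: "'a pair_pre_digraph \<Rightarrow> bool" where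
  "transitive_tournament T \<longleftrightarrow> tournament T \<and>
     \<not> (\<exists>u v w. (u, v) \<in> parcs T \<and> (v, w) \<in> parcs T \<and> (w, u) \<in> parcs T)"

definition switch :: "'a pair_pre_digraph \<Rightarrow> 'a set \<Rightarrow> 'a pair_pre_digraph" where
  "switch T W = \<lparr>pverts = pverts T,
     parcs = {(u, v) \<in> parcs T. u \<in> W \<longleftrightarrow> v \<in> W} \<union>
             {(v, u) | u v. (u, v) \<in> parcs T \<and> \<not> (u \<in> W \<longleftrightarrow> v \<in> W)}\<rparr>"

definition switching_equivalent :: "'a pair_pre_digraph \<Rightarrow> 'a pair_pre_digraph \<Rightarrow> bool" where
  "switching_equivalent T T' \<longleftrightarrow>
     (\<exists>W\<subseteq>pverts T. T' = switch T W) \<or> (\<exists>W\<subseteq>pverts T'. T = switch T' W)"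

text \<open>
  \<open>is_transitive_blowup R a T\<close> says that \<open>T\<close> is (a copy of) \<open>R(a)\<close>, where \<open>P v\<close> is the vertex
  set of the transitive tournament replacing \<open>v\<close>.
\<close>

definition is_transitive_blowup ::
  "'b pair_pre_digraph \<Rightarrow> ('b \<Rightarrow> nat) \<Rightarrow> 'a pair_pre_digraph \<Rightarrow> bool" where
  "is_transitive_blowup R a T \<longleftrightarrow> tournament T \<and>
     (\<exists>P. pverts T = (\<Union>v\<in>pverts R. P v) \<and> disjoint_family_on P (pverts R) \<and>
          (\<forall>v\<in>pverts R. card (P v) = a v \<and> transitive_tournament (subtournament T (P v))) \<and>
          (\<forall>(v, w)\<in>parcs R. P v \<times> P w \<subseteq> parcs T))"

definition L_tournament :: "nat \<Rightarrow> nat pair_pre_digraph" where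
  "L_tournament n = \<lparr>pverts = {1..n},
     parcs = {(i, j). 1 \<le> i \<and> i < j \<and> j \<le> n - 1} \<union>
             {(n, i) | i. 1 \<le> i \<and> i \<le> n - 1 \<and> odd i} \<union>
             {(i, n) | i. 1 \<le> i \<and> i \<le> n - 1 \<and> even i}\<rparr>"

lemma L_tournament_arc_iff:
  "(i, j) \<in> parcs (L_tournament n) \<longleftrightarrow>
     i \<in> {1..n} \<and> j \<in> {1..n} \<and> i \<noteq> j \<and>
     (if i = n then odd j else if j = n then even i else i < j)"
  by (cases "i = n"; cases "j = n") (auto simp: L_tournament_def)

lemma tournament_L_tournament: "tournament (L_tournament n)"
proof -
  have verts: "pverts (L_tournament n) = {1..n}"
    by (simp add: L_tournament_def)
  have "parcs (L_tournament n) \<subseteq> {1..n} \<times> {1..n}"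
    by (auto simp: L_tournament_arc_iff)
  then have "finite (parcs (L_tournament n))"
    by (rule finite_subset) simp
  then have "pair_digraph (L_tournament n)"
    by unfold_locales (auto simp: L_tournament_arc_iff verts)
  moreover have "(u, v) \<in> parcs (L_tournament n) \<longleftrightarrow> (v, u) \<notin> parcs (L_tournament n)"
    if "u \<in> {1..n}" "v \<in> {1..n}" "u \<noteq> v" for u v
    using that by (simp only: L_tournament_arc_iff) auto
  ultimately show ?thesis
    unfolding tournament_def verts by blast
qed

end

theory Submission
  imports Defs
begin

text \<open>
  Let \<open>s u v = \<plusminus>1\<close> be the signs of the arcs. Switching does not change principal minors, so one may
  argue up to signs.

  If \<open>u\<close> and \<open>v\<close> are twins (equal signs towards all other vertices), deleting both does not change
  the determinant. Hence every minor of a transitive blowup of \<open>R\<close> is a minor of \<open>R\<close>, and for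
  \<open>R = L\<^sub>6\<close> the largest one is \<open>det L\<^sub>6 = 25\<close>.

  Conversely, start from a base set \<open>B\<close> such that every vertex is, up to sign, a twin over \<open>B\<close> of
  some member of \<open>B\<close>. Then the tournament is a transitive blowup of \<open>B\<close> unless one of two
  obstructions occurs. A cyclic triple inside a class multiplies the minor of \<open>B\<close> by \<open>9\<close>. A \<^emph>\<open>bad
  pair\<close> \<open>v, w\<close>, whose arc disagrees with that of the representatives \<open>i, j\<close>, gives the Pfaffian
  \<open>\<plusminus>pf (B - {i, j}) \<plusminus> 2 pf B\<close> on \<open>B \<union> {v, w}\<close>.

  A tournament with a minor above \<open>9\<close> has a 4-set of determinant \<open>9\<close>, as otherwise it is
  switching equivalent to a transitive one. Any 4-set of determinant \<open>9\<close> is a base. If it has no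
  obstruction, all minors are at most \<open>9\<close>; if all minors are at most \<open>25\<close>, the only possible
  obstruction is a bad pair with Pfaffian \<open>\<plusminus>5\<close>, and the six vertices then form a switch of \<open>L\<^sub>6\<close>.
  This \<open>L\<^sub>6\<close> is again a base, because all columns that are not twins of a vertex produce a
  6-set of determinant at least \<open>49\<close>, and it has no obstruction since \<open>2 \<cdot> 5 - 3 > 5\<close>.
\<close>

section \<open>Principal minors of skew-symmetric matrices\<close>

text \<open>A list fixes the order of rows and columns without a choice; by
  \<open>principal_minor_set_cong\<close> only the set matters for distinct lists.\<close>

definition principal_minor :: "('a \<Rightarrow> 'a \<Rightarrow> 'b::comm_ring_1) \<Rightarrow> 'a list \<Rightarrow> 'b" where
  "principal_minor s vs = det (mat (length vs) (length vs) (\<lambda>(i, j). s (vs ! i) (vs ! j)))"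

lemma principal_minor_cong:
  assumes "\<And>x y. x \<in> set vs \<Longrightarrow> y \<in> set vs \<Longrightarrow> s x y = s' x y"
  shows "principal_minor s vs = principal_minor s' vs"
  unfolding principal_minor_def by (rule arg_cong[where f = det]) (auto intro!: eq_matI assms)

lemma principal_minor_map: "principal_minor s (map f vs) = principal_minor (\<lambda>x y. s (f x) (f y)) vs"
  unfolding principal_minor_def by (rule arg_cong[where f = det]) (auto intro!: eq_matI)

lemma principal_minor_sum_permutations:
  "principal_minor s vs =
     (\<Sum>p | p permutes {0..<length vs}. signof p * (\<Prod>i = 0..<length vs. s (vs ! i) (vs ! p i)))"
proof -
  have "(\<Prod>i = 0..<length vs. mat (length vs) (length vs) (\<lambda>(i, j). s (vs ! i) (vs ! j)) $$ (i, p i)) =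
      (\<Prod>i = 0..<length vs. s (vs ! i) (vs ! p i))" if "p permutes {0..<length vs}" for p
    using permutes_in_image[OF that] by (intro prod.cong) auto
  then show ?thesis
    unfolding principal_minor_def by (subst det_def'[of _ "length vs"]) auto
qed

text \<open>In every term of the Leibniz formula each vertex contributes its factor twice, once as a
  row and once as a column.\<close>

lemma principal_minor_scale:
  "principal_minor (\<lambda>x y. f x * f y * s x y) vs =
     (\<Prod>i = 0..<length vs. f (vs ! i))\<^sup>2 * principal_minor s vs"
proof -
  let ?n = "length vs"
  have "(\<Prod>i = 0..<?n. f (vs ! i) * f (vs ! p i) * s (vs ! i) (vs ! p i)) =
      (\<Prod>i = 0..<?n. f (vs ! i))\<^sup>2 * (\<Prod>i = 0..<?n. s (vs ! i) (vs ! p i))"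
    if "p permutes {0..<?n}" for p
  proof -
    have "(\<Prod>i = 0..<?n. f (vs ! p i)) = (\<Prod>i = 0..<?n. f (vs ! i))"
      using prod.permute[OF that, of "\<lambda>i. f (vs ! i)"] by (simp add: comp_def)
    then show ?thesis by (simp add: prod.distrib power2_eq_square)
  qed
  then show ?thesis
    unfolding principal_minor_sum_permutations sum_distrib_left
    by (intro sum.cong) (auto simp: ac_simps)
qed

text \<open>The same permutation acts on rows and on columns, so its sign enters squared.\<close>

lemma principal_minor_mset_cong:
  assumes "mset ws = mset vs"
  shows "principal_minor s ws = principal_minor s vs"
proof -
  let ?n = "length vs"
  obtain p where p: "p permutes {..<?n}" and ws: "permute_list p vs = ws"
    using assms by (rule mset_eq_permutation)
  have p': "p permutes {0..<?n}" using p by (simp add: atLeast0LessThan)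
  define A where "A = mat ?n ?n (\<lambda>(i, j). s (vs ! i) (vs ! j))"
  define B where "B = mat ?n ?n (\<lambda>(i, j). A $$ (p i, j))"
  have A: "A \<in> carrier_mat ?n ?n" and B: "B \<in> carrier_mat ?n ?n" by (simp_all add: A_def B_def)
  have lt: "p i < ?n" if "i < ?n" for i using permutes_in_image[OF p, of i] that by simp
  have len: "length ws = ?n" using assms mset_eq_length by blast
  have "mat ?n ?n (\<lambda>(i, j). s (ws ! i) (ws ! j)) =
      transpose_mat (mat ?n ?n (\<lambda>(i, j). transpose_mat B $$ (p i, j)))"
    by (rule eq_matI) (auto simp: A_def B_def permute_list_nth[OF p] lt simp flip: ws)
  then have "principal_minor s ws = det (mat ?n ?n (\<lambda>(i, j). transpose_mat B $$ (p i, j)))"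
    by (simp add: principal_minor_def len det_transpose[of _ ?n])
  also have "\<dots> = signof p * det (transpose_mat B)"
    by (rule det_permute_rows[OF _ p']) (use B in simp)
  also have "\<dots> = signof p * det B"
    using B by (simp add: det_transpose[of _ ?n])
  also have "\<dots> = signof p * (signof p * det A)"
    unfolding B_def by (subst det_permute_rows[OF A p']) simp
  also have "\<dots> = principal_minor s vs"
    by (simp add: sign_def principal_minor_def A_def)
  finally show ?thesis .
qed

lemma principal_minor_set_cong:
  assumes "distinct vs" "distinct ws" "set ws = set vs"
  shows "principal_minor s ws = principal_minor s vs"
  using assms set_eq_iff_mset_eq_distinct by (intro principal_minor_mset_cong) blast

lemma principal_minor_Nil [simp]: "principal_minor s [] = 1"
  by (simp add: principal_minor_def)

definition skew :: "('a \<Rightarrow> 'a \<Rightarrow> int) \<Rightarrow> bool" where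
  "skew s \<longleftrightarrow> (\<forall>x y. s x y = - s y x)"

lemma skewD: "skew s \<Longrightarrow> s x y = - s y x"
  unfolding skew_def by blast

lemma skew_self: "skew s \<Longrightarrow> s x x = 0"
  using skewD[of s x x] by simp

text \<open>Transposition negates the matrix, so in odd order the determinant equals its own
  negative.\<close>

lemma principal_minor_odd:
  assumes "skew s" "odd (length vs)"
  shows "principal_minor s vs = 0"
proof -
  let ?n = "length vs"
  define A where "A = mat ?n ?n (\<lambda>(i, j). s (vs ! i) (vs ! j))"
  have A: "A \<in> carrier_mat ?n ?n" by (simp add: A_def)
  have "transpose_mat A = (- 1) \<cdot>\<^sub>m A"
    by (intro eq_matI) (auto simp: A_def intro: skewD[OF assms(1)])
  then have "det A = (- 1) ^ ?n * det A"
    using det_transpose[OF A] A by simp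
  then show ?thesis using assms(2) by (simp add: principal_minor_def A_def)
qed

text \<open>For \<open>s u v = \<plusminus>1\<close> this is the entry \<open>(x, y)\<close> of the
  Schur complement of the block on \<open>u, v\<close>; a sign is its own inverse, so no division
  occurs.\<close>

definition pivot :: "('a \<Rightarrow> 'a \<Rightarrow> int) \<Rightarrow> 'a \<Rightarrow> 'a \<Rightarrow> 'a \<Rightarrow> 'a \<Rightarrow> int" where
  "pivot s u v x y = s x y + s u v * (s x u * s v y - s x v * s u y)"

lemma skew_pivot: "skew s \<Longrightarrow> skew (pivot s u v)"
  unfolding skew_def
proof (intro allI)
  fix x y
  assume "\<forall>x y. s x y = - s y x"
  then have "s x y = - s y x" "s x u = - s u x" "s x v = - s v x" "s y u = - s u y" "s y v = - s v y"
    by blast+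
  then show "pivot s u v x y = - pivot s u v y x"
    unfolding pivot_def by (simp add: algebra_simps)
qed

text \<open>Schur complement of the block on \<open>u, v\<close>.\<close>

lemma principal_minor_pivot:
  assumes "skew s" and unit: "s u v \<in> {1, -1}"
  shows "principal_minor s (u # v # ws) = principal_minor (pivot s u v) ws"
proof -
  let ?n = "length ws" and ?e = "s u v"
  have e: "?e * ?e = 1" using unit by auto
  note sk = skewD[OF assms(1)]
  define A where "A = mat 2 2 (\<lambda>(i, j). s ((u # v # ws) ! i) ((u # v # ws) ! j))"
  define B where "B = mat 2 ?n (\<lambda>(i, j). s ((u # v # ws) ! i) (ws ! j))"
  define C where "C = mat ?n 2 (\<lambda>(i, j). s (ws ! i) ((u # v # ws) ! j))"
  define D where "D = mat ?n ?n (\<lambda>(i, j). s (ws ! i) (ws ! j))"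
  \<comment> \<open>This is \<open>- C A^-1\<close>: the unipotent block matrix built from
    \<open>X\<close> clears \<open>C\<close> and leaves the Schur complement \<open>E\<close> in
    place of \<open>D\<close>.\<close>
  define X where "X = mat ?n 2 (\<lambda>(i, j). if j = 0 then - ?e * s (ws ! i) v else ?e * s (ws ! i) u)"
  define E where "E = mat ?n ?n (\<lambda>(i, j). pivot s u v (ws ! i) (ws ! j))"
  have car: "A \<in> carrier_mat 2 2" "B \<in> carrier_mat 2 ?n" "C \<in> carrier_mat ?n 2" "D \<in> carrier_mat ?n ?n"
    "X \<in> carrier_mat ?n 2" "E \<in> carrier_mat ?n ?n"
    by (simp_all add: A_def B_def C_def D_def X_def E_def)
  have S: "mat (length (u # v # ws)) (length (u # v # ws)) (\<lambda>(i, j). s ((u # v # ws) ! i) ((u # v # ws) ! j)) =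
      four_block_mat A B C D" (is "?S = _")
    by (rule eq_matI)
      (auto simp: four_block_mat_def A_def B_def C_def D_def Let_def nth_Cons' less_2_cases_iff numeral_2_eq_2)
  have XA: "X * A + C = 0\<^sub>m ?n 2"
  proof (rule eq_matI)
    fix i j assume ij: "i < dim_row (0\<^sub>m ?n 2)" "j < dim_col (0\<^sub>m ?n 2)"
    then have "j = 0 \<or> j = 1" by auto
    then show "(X * A + C) $$ (i, j) = 0\<^sub>m ?n 2 $$ (i, j)"
      using ij unit skew_self[OF assms(1)] sk[of v u]
      by (auto simp: X_def A_def C_def scalar_prod_def numeral_2_eq_2)
  qed (use car in auto)
  have XB: "X * B + D = E"
    by (rule eq_matI)
      (auto simp: X_def B_def D_def E_def pivot_def scalar_prod_def numeral_2_eq_2 algebra_simps)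
  have "four_block_mat (1\<^sub>m 2) (0\<^sub>m 2 ?n) X (1\<^sub>m ?n) * ?S = four_block_mat A B (0\<^sub>m ?n 2) E"
    unfolding S using car
    by (subst mult_four_block_mat[of _ 2 2 _ ?n _ ?n _ _ 2 _ ?n]) (auto simp: XA XB)
  moreover have "four_block_mat (1\<^sub>m 2) (0\<^sub>m 2 ?n) X (1\<^sub>m ?n) \<in> carrier_mat (2 + ?n) (2 + ?n)"
    "?S \<in> carrier_mat (2 + ?n) (2 + ?n)"
    using car by auto
  ultimately have "det (four_block_mat (1\<^sub>m 2) (0\<^sub>m 2 ?n) X (1\<^sub>m ?n)) * det ?S = det A * det E"
    using det_mult det_four_block_mat_lower_left_zero[OF car(1,2) refl car(6)] by metis
  moreover have "det (four_block_mat (1\<^sub>m 2) (0\<^sub>m 2 ?n) X (1\<^sub>m ?n)) = 1"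
    using car by (subst det_four_block_mat_upper_right_zero[of _ 2 _ ?n]) auto
  moreover have "det A = 1"
  proof -
    have "det A = (\<Sum>j<2. A $$ (0, j) * cofactor A 0 j)"
      using laplace_expansion_row[OF car(1), of 0] by simp
    also have "\<dots> = 1"
      using e skew_self[OF assms(1)] sk[of v u]
      by (simp add: numeral_2_eq_2 A_def cofactor_def mat_delete_def det_single)
    finally show ?thesis .
  qed
  ultimately show ?thesis by (simp add: principal_minor_def E_def)
qed

section \<open>Pfaffians of order four and six\<close>

definition pf4 :: "('a \<Rightarrow> 'a \<Rightarrow> int) \<Rightarrow> 'a \<Rightarrow> 'a \<Rightarrow> 'a \<Rightarrow> 'a \<Rightarrow> int" where
  "pf4 s a b c d = s a b * s c d - s a c * s b d + s a d * s b c"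

text \<open>The Pfaffian of order six, expanded along the row of \<open>a\<close>.\<close>

definition pf6 :: "('a \<Rightarrow> 'a \<Rightarrow> int) \<Rightarrow> 'a \<Rightarrow> 'a \<Rightarrow> 'a \<Rightarrow> 'a \<Rightarrow> 'a \<Rightarrow> 'a \<Rightarrow> int" where
  "pf6 s a b c d e f = s a b * pf4 s c d e f - s a c * pf4 s b d e f + s a d * pf4 s b c e f
     - s a e * pf4 s b c d f + s a f * pf4 s b c d e"

text \<open>Laplace expansion along the first row, with the submatrices again in the form
  \<open>mat\<close>, so that it can be iterated by rewriting.\<close>

lemma det_mat_Suc:
  fixes f :: "nat \<times> nat \<Rightarrow> 'a::comm_ring_1"
  shows "det (mat (Suc n) (Suc n) f) =
     (\<Sum>j<Suc n. f (0, j) * (-1) ^ j * det (mat n n (\<lambda>(i, k). f (Suc i, if k < j then k else Suc k))))"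
proof -
  have "mat_delete (mat (Suc n) (Suc n) f) 0 j = mat n n (\<lambda>(i, k). f (Suc i, if k < j then k else Suc k))"
    if "j < Suc n" for j
    using that by (intro eq_matI) (auto simp: mat_delete_def)
  then show ?thesis
    by (subst laplace_expansion_row[of _ "Suc n" 0])
      (auto simp: cofactor_def mult.assoc simp del: sum.lessThan_Suc intro!: sum.cong)
qed

lemma det_mat_3:
  fixes f :: "nat \<times> nat \<Rightarrow> 'a::comm_ring_1"
  shows "det (mat (Suc (Suc (Suc 0))) (Suc (Suc (Suc 0))) f) =
    f (0, 0) * (f (1, 1) * f (2, 2) - f (1, 2) * f (2, 1))
    - f (0, 1) * (f (1, 0) * f (2, 2) - f (1, 2) * f (2, 0))
    + f (0, 2) * (f (1, 0) * f (2, 1) - f (1, 1) * f (2, 0))"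
  by (simp add: det_mat_Suc numeral_2_eq_2 algebra_simps)

lemma principal_minor_4:
  assumes "skew s"
  shows "principal_minor s [a, b, c, d] = (pf4 s a b c d)\<^sup>2"
proof -
  have *: "s b a = - s a b" "s c a = - s a c" "s c b = - s b c" "s d a = - s a d" "s d b = - s b d"
    "s d c = - s c d" "s x x = 0" for x
    using skewD[OF assms] skew_self[OF assms] by blast+
  have "principal_minor s [a, b, c, d] =
    (\<Sum>j<4. s a ([a, b, c, d] ! j) * (-1) ^ j *
       det (mat (Suc (Suc (Suc 0))) (Suc (Suc (Suc 0))) (\<lambda>(i, k). s ([b, c, d] ! i) ([a, b, c, d] ! (if k < j then k else Suc k)))))"
    unfolding principal_minor_def length_Cons list.size(3)
    by (subst det_mat_Suc) (simp add: numeral_eq_Suc)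
  also have "\<dots> = (pf4 s a b c d)\<^sup>2"
    unfolding det_mat_3 pf4_def
    by (simp add: numeral_eq_Suc * algebra_simps)
  finally show ?thesis .
qed

text \<open>One pivot on the unit entry \<open>s a b\<close> reduces order six to order four and
  avoids expanding a determinant of order six.\<close>

lemma principal_minor_6:
  assumes "skew s" "s a b \<in> {1, -1}"
  shows "principal_minor s [a, b, c, d, e, f] = (pf6 s a b c d e f)\<^sup>2"
proof -
  note sk = skewD[OF assms(1)]
  have e: "s a b * s a b = 1" using assms(2) by auto
  have *: "s c a = - s a c" "s c b = - s b c" "s d a = - s a d" "s d b = - s b d"
    "s e a = - s a e" "s e b = - s b e"
    using sk by blast+
  consider "s a b = 1" | "s a b = -1" using assms(2) by auto
  \<comment> \<open>The Pfaffian of a Schur complement is the quotient of the Pfaffians; dividing by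
    the sign \<open>s a b\<close> is multiplying by it.\<close>
  then have "pf4 (pivot s a b) c d e f = s a b * pf6 s a b c d e f"
    by cases (simp_all add: pf4_def pf6_def pivot_def * algebra_simps)
  then show ?thesis
    using e by (simp add: principal_minor_pivot[OF assms] principal_minor_4[OF skew_pivot[OF assms(1)]]
        power_mult_distrib power2_eq_square)
qed


text \<open>For twins the correction term of \<open>pivot\<close> vanishes, so the Schur complement
  is the original matrix on \<open>ws\<close>.\<close>

lemma principal_minor_twins:
  assumes "skew s" "s u v \<in> {1, -1}" and twins: "\<And>x. x \<in> set ws \<Longrightarrow> s x u = s x v"
  shows "principal_minor s (u # v # ws) = principal_minor s ws"
proof -
  have "pivot s u v x y = s x y" if "x \<in> set ws" "y \<in> set ws" for x y
    using twins[OF that(1)] twins[OF that(2)] skewD[OF assms(1), of u y] skewD[OF assms(1), of v y]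
    by (simp add: pivot_def)
  then show ?thesis
    using principal_minor_pivot[OF assms(1,2), of ws] by (metis principal_minor_cong)
qed

lemma principal_minor_2:
  assumes "skew s" "s u v \<in> {1, -1}"
  shows "principal_minor s [u, v] = 1"
  using principal_minor_twins[OF assms, of "[]"] by simp

text \<open>Pivoting on \<open>u, v\<close> triples the entries between \<open>w\<close> and
  \<open>ws\<close>, as \<open>u\<close> and \<open>v\<close> each add a copy of the row of
  \<open>w\<close>, and keeps all others. Scaling row and column of \<open>w\<close> by 3 gives the
  factor 9.\<close>

lemma principal_minor_cyclic_triple:
  assumes "skew s" and cyc: "s u v = 1" "s v w = 1" "s w u = 1"
    and twins: "\<And>x. x \<in> set ws \<Longrightarrow> s x u = s x w \<and> s x v = s x w" and w: "w \<notin> set ws"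
  shows "principal_minor s (u # v # w # ws) = 9 * principal_minor s (w # ws)"
proof -
  define f :: "'a \<Rightarrow> int" where "f = (\<lambda>x. if x = w then 3 else 1)"
  note sk = skewD[OF assms(1)]
  have "pivot s u v x y = f x * f y * s x y" if xy: "x \<in> set (w # ws)" "y \<in> set (w # ws)" for x y
  proof (cases "x = w"; cases "y = w")
    assume "x = w" "y = w"
    then show ?thesis
      using cyc sk[of w v] sk[of u w] skew_self[OF assms(1), of w] by (simp add: pivot_def)
  next
    assume "x = w" "y \<noteq> w"
    then show ?thesis
      using cyc sk[of w v] sk[of v y] sk[of u y] sk[of w y] twins[of y] xy by (simp add: pivot_def f_def)
  next
    assume "x \<noteq> w" "y = w"
    then show ?thesis
      using cyc sk[of u w] twins[of x] xy by (simp add: pivot_def f_def)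
  next
    assume "x \<noteq> w" "y \<noteq> w"
    then show ?thesis
      using cyc sk[of v y] sk[of u y] twins[of x] twins[of y] xy by (simp add: pivot_def f_def)
  qed
  then have "principal_minor s (u # v # w # ws) = principal_minor (\<lambda>x y. f x * f y * s x y) (w # ws)"
    using principal_minor_pivot[OF assms(1), of u v "w # ws"] cyc(1)
    by (metis (no_types, lifting) insertI1 principal_minor_cong)
  also have "\<dots> = (f w * (\<Prod>i = 0..<length ws. f (ws ! i)))\<^sup>2 * principal_minor s (w # ws)"
    unfolding principal_minor_scale by (simp add: prod.atLeast0_lessThan_Suc_shift del: prod.op_ivl_Suc)
  also have "(\<Prod>i = 0..<length ws. f (ws ! i)) = 1"
    using w nth_mem by (intro prod.neutral) (fastforce simp: f_def)
  finally show ?thesis by (simp add: f_def)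
qed

text \<open>
  The Pfaffian is affine in the entry \<open>s v w\<close>, with cofactor \<open>pf6\<close>; for the value \<open>s i j\<close> the pairs
  \<open>v, i\<close> and \<open>w, j\<close> would be twins and only \<open>pf4\<close> would remain.
\<close>

lemma principal_minor_bad_pair:
  assumes "skew s" and unit: "s v i \<in> {1, -1}" "s a b \<in> {1, -1}" "s i j \<in> {1, -1}"
    and v: "s v a = s i a" "s v b = s i b" "s v c = s i c" "s v d = s i d" "s v j = s i j"
    and w: "s w a = s j a" "s w b = s j b" "s w c = s j c" "s w d = s j d" "s w i = s j i"
    and vw: "s v w = - s i j"
  shows "principal_minor s [v, i, a, b, c, d, w, j] =
    (s w j * pf4 s a b c d + 2 * s v i * s i j * pf6 s a b c d i j)\<^sup>2"
proof -
  note sk = skewD[OF assms(1)]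
  let ?p = "pivot s v i"
  \<comment> \<open>\<open>v\<close> and \<open>i\<close> are twins over these vertices, so the
    pivot changes nothing here.\<close>
  have base: "?p x y = s x y" if "x \<in> {a, b, c, d, j}" "y \<in> {a, b, c, d, j}" for x y
    using that v sk[of x i] sk[of x v] by (auto simp: pivot_def)
  have wi: "s w i = - s i j" and wv: "s w v = s i j"
    using w(5) vw sk[of j i] sk[of w v] by auto
  \<comment> \<open>\<open>v\<close> and \<open>i\<close> differ only towards \<open>w\<close>. So
    the column of \<open>w\<close> becomes that of its twin \<open>j\<close> plus
    \<open>2 * s v i * s i j\<close> times that of \<open>i\<close>, except for the extra
    \<open>s w j\<close> between \<open>w\<close> and \<open>j\<close>, which brings in
    \<open>pf4\<close>.\<close>
  have wrow: "?p x w = s x j + 2 * s v i * s i j * s x i" if "x \<in> {a, b, c, d}" for x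
    using that v w vw sk[of x i] sk[of x v] sk[of x j] sk[of x w] sk[of i w] sk[of j i]
    by (auto simp: pivot_def algebra_simps)
  have wj: "?p w j = s w j + 2 * s v i"
    using wi wv v(5) unit(3) by (auto simp: pivot_def)
  have "principal_minor s [v, i, a, b, c, d, w, j] = principal_minor ?p [a, b, c, d, w, j]"
    by (rule principal_minor_pivot[OF assms(1) unit(1)])
  also have "\<dots> = (pf6 ?p a b c d w j)\<^sup>2"
    by (rule principal_minor_6[OF skew_pivot[OF assms(1)]]) (use base[of a b] unit(2) in simp)
  also have "pf6 ?p a b c d w j = s w j * pf4 s a b c d + 2 * s v i * s i j * pf6 s a b c d i j"
    using unit(3) by (auto simp: pf6_def pf4_def base wrow wj algebra_simps)
  finally show ?thesis .
qed

section \<open>Sign tournaments and transitive classes\<close>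

text \<open>Skewness is asked on the whole type, the values \<plusminus>1 only on \<open>V\<close>;
  \<open>arc_sign\<close> has both properties, being 0 on pairs without an arc.\<close>

locale sign_tournament =
  fixes V :: "'a set" and s :: "'a \<Rightarrow> 'a \<Rightarrow> int"
  assumes finite_V: "finite V" and skew: "skew s"
    and sign: "\<And>u v. u \<in> V \<Longrightarrow> v \<in> V \<Longrightarrow> u \<noteq> v \<Longrightarrow> s u v \<in> {1, -1}"
begin

lemma sign_cases:
  assumes "u \<in> V" "v \<in> V" "u \<noteq> v"
  obtains "s u v = 1" "s v u = -1" | "s u v = -1" "s v u = 1"
  using sign[OF assms] skewD[OF skew, of v u] by auto

text \<open>Odd orders vanish, orders zero and two give 1, and a Pfaffian of order four is a sum of
  three signs.\<close>

lemma principal_minor_le_9: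
  assumes "distinct vs" "set vs \<subseteq> V" "length vs \<le> 5"
  shows "principal_minor s vs \<le> 9"
proof (cases "odd (length vs)")
  case True
  then show ?thesis by (simp add: principal_minor_odd[OF skew])
next
  case False
  with assms(3) have "length vs = 0 \<or> length vs = 2 \<or> length vs = 4" by presburger
  then consider "length vs = 0" | "length vs = 2" | "length vs = 4" by blast
  then show ?thesis
  proof cases
    case 1
    then show ?thesis by simp
  next
    case 2
    then obtain u v where "vs = [u, v]" by (auto simp: length_Suc_conv numeral_eq_Suc)
    then show ?thesis using assms principal_minor_2[OF skew, of u v] sign[of u v] by auto
  next
    case 3
    then obtain a b c d where vs: "vs = [a, b, c, d]" by (auto simp: length_Suc_conv numeral_eq_Suc)
    have "s a b \<in> {1, -1}" "s a c \<in> {1, -1}" "s a d \<in> {1, -1}" "s b c \<in> {1, -1}" "s b d \<in> {1, -1}"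
      "s c d \<in> {1, -1}"
      using assms vs sign[of a b] sign[of a c] sign[of a d] sign[of b c] sign[of b d] sign[of c d] by auto
    then have "\<bar>pf4 s a b c d\<bar> \<le> 3" by (auto simp: pf4_def)
    then show ?thesis
      using abs_le_square_iff[of "pf4 s a b c d" 3] by (simp add: vs principal_minor_4[OF skew])
  qed
qed

text \<open>Induction: a new vertex \<open>x\<close> either loses to the old source \<open>u\<close>
  or beats it. In the latter case it beats every other \<open>y\<close> as well, since otherwise
  \<open>x, u, y\<close> would be a cycle.\<close>

lemma ex_source:
  assumes "finite F" "F \<noteq> {}" "F \<subseteq> V"
    and "\<And>u v w. u \<in> F \<Longrightarrow> v \<in> F \<Longrightarrow> w \<in> F \<Longrightarrow> \<not> (s u v = 1 \<and> s v w = 1 \<and> s w u = 1)"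
  shows "\<exists>u\<in>F. \<forall>x\<in>F - {u}. s u x = 1"
  using assms
proof (induction rule: finite_ne_induct)
  case (singleton x)
  then show ?case by simp
next
  case (insert x F)
  then obtain u where u: "u \<in> F" "\<forall>y\<in>F - {u}. s u y = 1" by auto
  have "x \<in> V" "u \<in> V" "x \<noteq> u" using insert u by auto
  then show ?case
  proof (cases rule: sign_cases)
    case 1
    have "s x y = 1" if "y \<in> F" for y
    proof (rule ccontr)
      assume "s x y \<noteq> 1"
      moreover have "x \<noteq> y" "y \<in> V" using that insert by auto
      ultimately have yx: "s y x = 1" using \<open>x \<in> V\<close> sign[of x y] skewD[OF skew, of y x] by auto
      moreover have "y \<noteq> u" using yx 1 by auto
      ultimately show False using insert.prems(2)[of x u y] u 1 that by auto
    qed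
    then show ?thesis by auto
  next
    case 2
    then show ?thesis using u by auto
  qed
qed

end

text \<open>A transitive blowup in terms of signs: \<open>c\<close> names the block of a vertex and
  \<open>l\<close> the signs between blocks. Block names have their own type, so they can be
  vertices of L6 or representatives in \<open>V\<close>.\<close>

definition transitive_classes :: "('b \<Rightarrow> 'b \<Rightarrow> int) \<Rightarrow> ('a \<Rightarrow> 'b) \<Rightarrow> 'a set \<Rightarrow> ('a \<Rightarrow> 'a \<Rightarrow> int) \<Rightarrow> bool" where
  "transitive_classes l c V s \<longleftrightarrow>
     (\<forall>u\<in>V. \<forall>v\<in>V. c u \<noteq> c v \<longrightarrow> s u v = l (c u) (c v)) \<and>
     (\<forall>u\<in>V. \<forall>v\<in>V. \<forall>w\<in>V. c u = c v \<longrightarrow> c v = c w \<longrightarrow> \<not> (s u v = 1 \<and> s v w = 1 \<and> s w u = 1))"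

lemma transitive_classesD:
  assumes "transitive_classes l c V s" "u \<in> V" "v \<in> V"
  shows "c u \<noteq> c v \<Longrightarrow> s u v = l (c u) (c v)"
    and "w \<in> V \<Longrightarrow> c u = c v \<Longrightarrow> c v = c w \<Longrightarrow> \<not> (s u v = 1 \<and> s v w = 1 \<and> s w u = 1)"
  using assms unfolding transitive_classes_def by blast+

context sign_tournament
begin

text \<open>If two vertices share a class, the first two of that class in its transitive order are
  twins and can be deleted. Repeating this leaves at most one vertex per class.\<close>

lemma transversal_principal_minor:
  assumes "transitive_classes l c V s" "distinct vs" "set vs \<subseteq> V"
  shows "\<exists>ws. distinct ws \<and> set ws \<subseteq> set vs \<and> inj_on c (set ws) \<and> principal_minor s vs = principal_minor s ws"
  using assms(2,3)
proof (induction "length vs" arbitrary: vs rule: less_induct)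
  case less
  show ?case
  proof (cases "inj_on c (set vs)")
    case True
    then show ?thesis using less.prems by blast
  next
    case False
    then obtain x y where xy: "x \<in> set vs" "y \<in> set vs" "x \<noteq> y" "c x = c y"
      by (auto simp: inj_on_def)
    define F where "F = {z \<in> set vs. c z = c x}"
    have F: "finite F" "F \<subseteq> V" using less.prems by (auto simp: F_def)
    have acyc: "\<not> (s u v = 1 \<and> s v w = 1 \<and> s w u = 1)" if "u \<in> F" "v \<in> F" "w \<in> F" for u v w
      using transitive_classesD(2)[OF assms(1), of u v w] less.prems that by (auto simp: F_def)
    obtain u where u: "u \<in> F" "\<forall>z\<in>F - {u}. s u z = 1"
      using ex_source[of F] F acyc xy unfolding F_def by blast
    have "F - {u} \<noteq> {}" using xy by (auto simp: F_def)
    then obtain v where v: "v \<in> F - {u}" "\<forall>z\<in>F - {u} - {v}. s v z = 1"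
      using ex_source[of "F - {u}"] F acyc by blast
    define zs where "zs = filter (\<lambda>z. z \<noteq> u \<and> z \<noteq> v) vs"
    have zs: "distinct zs" "set zs = set vs - {u, v}" using less.prems by (auto simp: zs_def)
    have uv: "u \<in> set vs" "v \<in> set vs" "u \<noteq> v" using u v by (auto simp: F_def)
    have "s z u = s z v" if z: "z \<in> set zs" for z
    proof (cases "z \<in> F")
      case True
      then have "s u z = 1" "s v z = 1" using z zs u v by auto
      then show ?thesis using skewD[OF skew, of z u] skewD[OF skew, of z v] by simp
    next
      case False
      then have "c z \<noteq> c u" "c z \<noteq> c v" "c u = c v" using z zs u v by (auto simp: F_def)
      moreover have "z \<in> V" "u \<in> V" "v \<in> V" using z zs less.prems uv by auto
      ultimately show ?thesis
        using transitive_classesD(1)[OF assms(1), of z u] transitive_classesD(1)[OF assms(1), of z v]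
        by simp
    qed
    then have "principal_minor s (u # v # zs) = principal_minor s zs"
      using uv less.prems by (intro principal_minor_twins[OF skew sign]) auto
    moreover have "principal_minor s vs = principal_minor s (u # v # zs)"
      using uv zs less.prems by (intro principal_minor_set_cong) auto
    moreover have "length zs < length vs"
      using uv(1) unfolding zs_def by (intro length_filter_less) auto
    moreover from this obtain ws where "distinct ws" "set ws \<subseteq> set zs" "inj_on c (set ws)"
      "principal_minor s zs = principal_minor s ws"
      using less.hyps[of zs] zs less.prems by auto
    ultimately show ?thesis using zs by auto
  qed
qed

end


section \<open>Switching as conjugation by a diagonal sign matrix\<close>

definition switched :: "('a \<Rightarrow> int) \<Rightarrow> ('a \<Rightarrow> 'a \<Rightarrow> int) \<Rightarrow> 'a \<Rightarrow> 'a \<Rightarrow> int" where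
  "switched e s x y = e x * e y * s x y"

definition minors_le :: "int \<Rightarrow> 'a set \<Rightarrow> ('a \<Rightarrow> 'a \<Rightarrow> int) \<Rightarrow> bool" where
  "minors_le m V s \<longleftrightarrow> (\<forall>vs. distinct vs \<longrightarrow> set vs \<subseteq> V \<longrightarrow> principal_minor s vs \<le> m)"

lemma minors_leD: "minors_le m V s \<Longrightarrow> distinct vs \<Longrightarrow> set vs \<subseteq> V \<Longrightarrow> principal_minor s vs \<le> m"
  unfolding minors_le_def by blast

lemma switched_switched: "switched e (switched e' s) = switched (\<lambda>x. e x * e' x) s"
  by (intro ext) (simp add: switched_def)

lemma skew_switched:
  assumes "skew s"
  shows "skew (switched e s)"
  unfolding skew_def
proof (intro allI)
  fix x y
  show "switched e s x y = - switched e s y x"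
    unfolding switched_def by (subst skewD[OF assms]) simp
qed

lemma principal_minor_switched:
  assumes "\<And>x. e x \<in> {1, -1}"
  shows "principal_minor (switched e s) vs = principal_minor s vs"
proof -
  have "(\<Prod>i = 0..<length vs. e (vs ! i))\<^sup>2 = (\<Prod>i = 0..<length vs. (e (vs ! i))\<^sup>2)"
    by (rule prod_power_distrib)
  also have "\<dots> = 1"
    by (intro prod.neutral) (use assms in \<open>auto simp: power2_eq_1_iff\<close>)
  finally show ?thesis
    using principal_minor_scale[of e s vs] by (simp add: switched_def[abs_def])
qed

lemma minors_le_switched:
  assumes "\<And>x. e x \<in> {1, -1}"
  shows "minors_le m V (switched e s) \<longleftrightarrow> minors_le m V s"
  by (simp add: minors_le_def principal_minor_switched[OF assms])

context sign_tournament
begin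

lemma sign_tournament_switched:
  assumes "\<And>x. e x \<in> {1, -1}"
  shows "sign_tournament V (switched e s)"
proof
  fix u v assume "u \<in> V" "v \<in> V" "u \<noteq> v"
  then show "switched e s u v \<in> {1, -1}"
    using sign[of u v] assms[of u] assms[of v] by (auto simp: switched_def)
qed (use finite_V skew_switched[OF skew] in auto)

text \<open>Switch so that some \<open>r\<close> becomes a source. A cyclic triple then consists of
  twins over \<open>r\<close> and yields a minor 9; without one the switched tournament is a single
  transitive class.\<close>

lemma minors_le_9_if_no_9:
  assumes "\<And>a b c d. distinct [a, b, c, d] \<Longrightarrow> {a, b, c, d} \<subseteq> V \<Longrightarrow> principal_minor s [a, b, c, d] \<noteq> 9"
  shows "minors_le 9 V s"
proof (cases "V = {}")
  case True
  then show ?thesis by (simp add: minors_le_def)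
next
  case False
  then obtain r where r: "r \<in> V" by blast
  define e where "e = (\<lambda>x. if x \<in> V - {r} then s r x else 1)"
  have e: "e x \<in> {1, -1}" for x using sign[of r x] r by (auto simp: e_def)
  interpret sw: sign_tournament V "switched e s" by (rule sign_tournament_switched[OF e])
  have source: "switched e s r x = 1" if "x \<in> V" "x \<noteq> r" for x
    using sign[of r x] r that by (auto simp: e_def switched_def)
  have not_r: "x \<noteq> r" if "switched e s y x = 1" "y \<in> V" for x y
  proof
    assume "x = r"
    moreover have "y \<noteq> r" using that skew_self[OF sw.skew, of r] \<open>x = r\<close> by auto
    ultimately show False using that source[of y] skewD[OF sw.skew, of r y] by simp
  qed
  have "\<not> (switched e s u v = 1 \<and> switched e s v w = 1 \<and> switched e s w u = 1)"
    if V: "u \<in> V" "v \<in> V" "w \<in> V" for u v w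
  proof
    assume cyc: "switched e s u v = 1 \<and> switched e s v w = 1 \<and> switched e s w u = 1"
    then have r': "u \<noteq> r" "v \<noteq> r" "w \<noteq> r" using not_r[of w u] not_r[of u v] not_r[of v w] V by simp_all
    have "u \<noteq> v" "v \<noteq> w" "w \<noteq> u"
      using cyc skew_self[OF sw.skew, of u] skew_self[OF sw.skew, of v] by auto
    moreover have "principal_minor (switched e s) [u, v, w, r] = 9 * principal_minor (switched e s) [w, r]"
      by (rule principal_minor_cyclic_triple[OF sw.skew]) (use cyc r' V source[of u] source[of v] source[of w] in auto)
    moreover have "principal_minor (switched e s) [w, r] = 1"
      by (rule principal_minor_2[OF sw.skew sw.sign]) (use V r r' in auto)
    ultimately show False
      using assms[of u v w r] r' V r by (simp add: principal_minor_switched[OF e])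
  qed
  \<comment> \<open>With a single class the sign function between classes is a dummy.\<close>
  then have cl: "transitive_classes (\<lambda>_ _. 0) (\<lambda>_. ()) V (switched e s)"
    unfolding transitive_classes_def by blast
  have "principal_minor (switched e s) vs \<le> 9" if vs: "distinct vs" "set vs \<subseteq> V" for vs
  proof -
    obtain ws where ws: "distinct ws" "set ws \<subseteq> set vs" "inj_on (\<lambda>_. ()) (set ws)"
      "principal_minor (switched e s) vs = principal_minor (switched e s) ws"
      using sw.transversal_principal_minor[OF cl vs] by blast
    have "length ws = card (set ws)" using ws(1) by (simp add: distinct_card)
    also have "\<dots> \<le> card (UNIV :: unit set)"
      by (rule card_inj_on_le[OF ws(3)]) auto
    finally show ?thesis
      using sw.principal_minor_le_9[of ws] ws vs by simp
  qed
  then show ?thesis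
    by (simp add: minors_le_def principal_minor_switched[OF e])
qed

end

text \<open>\<open>c v\<close> is the base vertex of which \<open>v\<close> is a twin. The twins
  agree exactly, signs being absorbed by a prior switching; the entry of \<open>v\<close> towards
  \<open>c v\<close> itself is left free.\<close>

locale twin_base = sign_tournament +
  fixes B :: "'a set" and c :: "'a \<Rightarrow> 'a"
  assumes base: "B \<subseteq> V" and rep_base: "\<And>b. b \<in> B \<Longrightarrow> c b = b"
    and rep_in: "\<And>v. v \<in> V \<Longrightarrow> c v \<in> B"
    and twin: "\<And>v k. v \<in> V \<Longrightarrow> k \<in> B \<Longrightarrow> k \<noteq> c v \<Longrightarrow> s v k = s (c v) k"
begin

lemma principal_minor_replace:
  assumes "w \<in> V" "set ws \<subseteq> B - {c w}"
  shows "principal_minor s (w # ws) = principal_minor s (c w # ws)"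
proof -
  define f where "f = (\<lambda>x. if x = c w then w else x)"
  have "map f ws = ws" using assms(2) by (intro map_idI) (auto simp: f_def)
  then have "principal_minor s (w # ws) = principal_minor s (map f (c w # ws))"
    by (simp add: f_def)
  also have "\<dots> = principal_minor s (c w # ws)"
    unfolding principal_minor_map
  proof (rule principal_minor_cong)
    fix x y assume xy: "x \<in> set (c w # ws)" "y \<in> set (c w # ws)"
    have k: "s w k = s (c w) k" "s k w = s k (c w)" if "k \<in> set ws" for k
      using twin[OF assms(1), of k] assms(2) that skewD[OF skew, of k w] skewD[OF skew, of k "c w"] by auto
    consider "x = c w" "y = c w" | "x = c w" "y \<in> set ws" | "x \<in> set ws" "y = c w" | "x \<in> set ws" "y \<in> set ws"
      using xy by auto
    then show "s (f x) (f y) = s x y"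
      by cases (use k assms(2) skew_self[OF skew] in \<open>auto simp: f_def\<close>)
  qed
  finally show ?thesis .
qed

text \<open>Putting the triple in place of its representative multiplies the minor of the base by 9,
  which exceeds \<open>m\<close>.\<close>

lemma no_cyclic_class:
  assumes "minors_le m V s" "distinct bs" "set bs = B" "m < 9 * principal_minor s bs"
    and V: "u \<in> V" "v \<in> V" "w \<in> V" and c: "c u = c v" "c v = c w"
  shows "\<not> (s u v = 1 \<and> s v w = 1 \<and> s w u = 1)"
proof
  assume cyc: "s u v = 1 \<and> s v w = 1 \<and> s w u = 1"
  then have dist: "u \<noteq> v" "v \<noteq> w" "w \<noteq> u" using skew_self[OF skew] by auto
  define ws where "ws = filter (\<lambda>x. x \<noteq> c w) bs"
  have ws: "distinct ws" "set ws = B - {c w}" using assms(2,3) by (auto simp: ws_def)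
  have notin: "x \<notin> set ws" if "x \<in> V" "c x = c w" for x
    using ws rep_base[of x] that by auto
  have "s x u = s x w \<and> s x v = s x w" if "x \<in> set ws" for x
    using twin[of u x] twin[of v x] twin[of w x] that ws V c
      skewD[OF skew, of x u] skewD[OF skew, of x v] skewD[OF skew, of x w] by auto
  then have "principal_minor s (u # v # w # ws) = 9 * principal_minor s (w # ws)"
    using cyc notin V by (intro principal_minor_cyclic_triple[OF skew]) auto
  also have "principal_minor s (w # ws) = principal_minor s (c w # ws)"
    using ws V by (intro principal_minor_replace) auto
  also have "\<dots> = principal_minor s bs"
    using ws assms(2,3) rep_in[OF V(3)] by (intro principal_minor_set_cong) auto
  finally have "principal_minor s (u # v # w # ws) = 9 * principal_minor s bs" .
  moreover have "principal_minor s (u # v # w # ws) \<le> m"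
    using ws notin V c dist base by (intro minors_leD[OF assms(1)]) auto
  ultimately show False using assms(4) by simp
qed

text \<open>A base vertex represents itself, so its arcs to other classes are the prescribed ones;
  hence a bad pair avoids the base. As there are only two signs, disagreement means
  negation.\<close>

lemma bad_pair:
  assumes V: "v \<in> V" "w \<in> V" and "c v \<noteq> c w" "s v w \<noteq> s (c v) (c w)"
  shows "v \<notin> B" "w \<notin> B" "s v w = - s (c v) (c w)"
proof -
  have "s v (c w) = s (c v) (c w)" "s w (c v) = s (c w) (c v)"
    using twin[of v "c w"] twin[of w "c v"] assms rep_in by auto
  then show "v \<notin> B" "w \<notin> B"
    using assms(4) rep_base[of v] rep_base[of w] skewD[OF skew, of v w] skewD[OF skew, of "c v" "c w"]
    by metis+
  have "c v \<in> V" "c w \<in> V" "v \<noteq> w" using rep_in V base assms(3) by auto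
  then show "s v w = - s (c v) (c w)"
    using assms sign[of v w] sign[of "c v" "c w"] by auto
qed

end

text \<open>Each outside vertex is switched by its own sign \<open>e\<close>, which turns a twin up
  to sign into a twin; the base is not switched.\<close>

lemma (in sign_tournament) ex_twin_base:
  assumes "B \<subseteq> V"
    and "\<And>v. v \<in> V - B \<Longrightarrow> \<exists>i\<in>B. \<exists>e\<in>{1, -1}. \<forall>k\<in>B - {i}. s v k = e * s i k"
  shows "\<exists>e c. (\<forall>x. e x \<in> {1, -1}) \<and> (\<forall>b\<in>B. e b = 1) \<and> twin_base V (switched e s) B c"
proof -
  obtain i e where ie: "\<And>v. v \<in> V - B \<Longrightarrow> i v \<in> B \<and> e v \<in> {1, -1} \<and> (\<forall>k\<in>B - {i v}. s v k = e v * s (i v) k)"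
    using assms(2) by metis
  define e' where "e' = (\<lambda>v. if v \<in> V - B then e v else 1)"
  define c where "c = (\<lambda>v. if v \<in> V - B then i v else v)"
  have e': "e' x \<in> {1, -1}" for x using ie[of x] by (auto simp: e'_def)
  interpret sw: sign_tournament V "switched e' s" by (rule sign_tournament_switched[OF e'])
  have "twin_base V (switched e' s) B c"
  proof
    fix v k assume vk: "v \<in> V" "k \<in> B" "k \<noteq> c v"
    show "switched e' s v k = switched e' s (c v) k"
    proof (cases "v \<in> B")
      case True
      then show ?thesis by (simp add: c_def)
    next
      case False
      then show ?thesis using ie[of v] vk by (auto simp: c_def e'_def switched_def)
    qed
  qed (use assms(1) ie in \<open>auto simp: c_def\<close>)
  moreover have "\<forall>b\<in>B. e' b = 1" by (simp add: e'_def)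
  ultimately show ?thesis using e' by blast
qed


section \<open>Columns over four vertices and over \<open>L\<^sub>6\<close>\<close>

text \<open>The three terms of the Pfaffian must be equal. Then no column matches two different rows
  up to sign, since these rows are neither equal nor opposite on the two remaining places. Four
  rows, two signs and one free entry thus give 16 distinct columns, which are all columns.\<close>

lemma four_vertex_column:
  fixes ab ac ad bc bd cd xa xb xc xd :: int
  assumes "ab \<in> {1, -1}" "ac \<in> {1, -1}" "ad \<in> {1, -1}" "bc \<in> {1, -1}" "bd \<in> {1, -1}" "cd \<in> {1, -1}"
    and "\<bar>ab * cd - ac * bd + ad * bc\<bar> = 3"
    and "xa \<in> {1, -1}" "xb \<in> {1, -1}" "xc \<in> {1, -1}" "xd \<in> {1, -1}"
  shows "\<exists>e\<in>{1, -1}. xb = e * ab \<and> xc = e * ac \<and> xd = e * ad \<or> xa = - e * ab \<and> xc = e * bc \<and> xd = e * bd \<or>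
    xa = - e * ac \<and> xb = - e * bc \<and> xd = e * cd \<or> xa = - e * ad \<and> xb = - e * bd \<and> xc = - e * cd"
proof -
  have "ab * cd = - ac * bd \<and> ad * bc = - ac * bd"
    using assms(1-7) by (elim insertE emptyE) simp_all
  then have "cd = - ab * ac * bd \<and> bc = - ad * ac * bd"
    using assms(1,3) by (elim insertE emptyE) simp_all
  then show ?thesis
    using assms(1-3,5,8-11) by (elim insertE emptyE) simp_all
qed

text \<open>
  The five linear forms are the Pfaffians of the 6-sets that arise by replacing one of the vertices
  \<open>u\<^sub>1, \<dots>, u\<^sub>5\<close> of \<open>L\<^sub>6\<close> by a vertex with column \<open>x\<close>; the case \<open>u\<^sub>6\<close> gives no constraint.
\<close>

lemma L6_column:
  fixes x1 x2 x3 x4 x5 x6 :: int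
  assumes "x1 \<in> {1, -1}" "x2 \<in> {1, -1}" "x3 \<in> {1, -1}" "x4 \<in> {1, -1}" "x5 \<in> {1, -1}" "x6 \<in> {1, -1}"
    and "\<bar>- 3 * x2 + x3 + x4 - 3 * x5 + x6\<bar> \<le> 5" "\<bar>- 3 * x1 + 3 * x3 - x4 - x5 + x6\<bar> \<le> 5"
      "\<bar>- x1 + 3 * x2 - 3 * x4 + x5 + x6\<bar> \<le> 5" "\<bar>x1 + x2 - 3 * x3 + 3 * x5 + x6\<bar> \<le> 5"
      "\<bar>3 * x1 - x2 - x3 + 3 * x4 + x6\<bar> \<le> 5"
  shows "\<exists>e\<in>{1, -1}. x2 = e \<and> x3 = e \<and> x4 = e \<and> x5 = e \<and> x6 = - e \<or>
    x1 = - e \<and> x3 = e \<and> x4 = e \<and> x5 = e \<and> x6 = e \<or>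
    x1 = - e \<and> x2 = - e \<and> x4 = e \<and> x5 = e \<and> x6 = - e \<or>
    x1 = - e \<and> x2 = - e \<and> x3 = - e \<and> x5 = e \<and> x6 = e \<or>
    x1 = - e \<and> x2 = - e \<and> x3 = - e \<and> x4 = - e \<and> x6 = - e \<or>
    x1 = e \<and> x2 = - e \<and> x3 = e \<and> x4 = - e \<and> x5 = e"
  using assms by (elim insertE emptyE) simp_all

section \<open>Labelled copies of L6\<close>

definition arc_sign :: "'a pair_pre_digraph \<Rightarrow> 'a \<Rightarrow> 'a \<Rightarrow> int" where
  "arc_sign T u v = (if (u, v) \<in> parcs T then 1 else if (v, u) \<in> parcs T then - 1 else 0)"

definition L6_labelling :: "('a \<Rightarrow> 'a \<Rightarrow> int) \<Rightarrow> (nat \<Rightarrow> 'a) \<Rightarrow> bool" where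
  "L6_labelling s b \<longleftrightarrow> inj_on b {1..6} \<and>
     (\<forall>p\<in>{1..6}. \<forall>q\<in>{1..6}. s (b p) (b q) = arc_sign (L_tournament 6) p q)"

lemma atLeastAtMost_1_6: "{1..6} = {1, 2, 3, 4, 5, 6::nat}"
  by auto

text \<open>Skewness reduces the 36 entries to the 15 above the diagonal, in a form suited to
  rewriting.\<close>

lemma L6_labelling_iff:
  assumes "skew s"
  shows "L6_labelling s b \<longleftrightarrow> distinct [b 1, b 2, b 3, b 4, b 5, b 6] \<and>
    s (b 1) (b 2) = 1 \<and> s (b 1) (b 3) = 1 \<and> s (b 1) (b 4) = 1 \<and> s (b 1) (b 5) = 1 \<and> s (b 1) (b 6) = -1 \<and>
    s (b 2) (b 3) = 1 \<and> s (b 2) (b 4) = 1 \<and> s (b 2) (b 5) = 1 \<and> s (b 2) (b 6) = 1 \<and>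
    s (b 3) (b 4) = 1 \<and> s (b 3) (b 5) = 1 \<and> s (b 3) (b 6) = -1 \<and>
    s (b 4) (b 5) = 1 \<and> s (b 4) (b 6) = 1 \<and> s (b 5) (b 6) = -1" (is "_ \<longleftrightarrow> ?R")
proof
  assume "L6_labelling s b"
  then show ?R
    unfolding L6_labelling_def atLeastAtMost_1_6 by (auto simp: arc_sign_def L_tournament_arc_iff)
next
  assume R: ?R
  moreover have "s (b p) (b p) = 0" for p by (rule skew_self[OF assms])
  moreover have
    "s (b 2) (b 1) = - s (b 1) (b 2)" "s (b 3) (b 1) = - s (b 1) (b 3)" "s (b 4) (b 1) = - s (b 1) (b 4)"
    "s (b 5) (b 1) = - s (b 1) (b 5)" "s (b 6) (b 1) = - s (b 1) (b 6)" "s (b 3) (b 2) = - s (b 2) (b 3)"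
    "s (b 4) (b 2) = - s (b 2) (b 4)" "s (b 5) (b 2) = - s (b 2) (b 5)" "s (b 6) (b 2) = - s (b 2) (b 6)"
    "s (b 4) (b 3) = - s (b 3) (b 4)" "s (b 5) (b 3) = - s (b 3) (b 5)" "s (b 6) (b 3) = - s (b 3) (b 6)"
    "s (b 5) (b 4) = - s (b 4) (b 5)" "s (b 6) (b 4) = - s (b 4) (b 6)" "s (b 6) (b 5) = - s (b 5) (b 6)"
    by (rule skewD[OF assms])+
  ultimately show "L6_labelling s b"
    unfolding L6_labelling_def atLeastAtMost_1_6 by (simp add: arc_sign_def L_tournament_arc_iff)
qed

lemma L6_labelling_nth:
  assumes "skew s" "distinct [b1, b2, b3, b4, b5, b6]"
    "s b1 b2 = 1" "s b1 b3 = 1" "s b1 b4 = 1" "s b1 b5 = 1" "s b1 b6 = -1"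
    "s b2 b3 = 1" "s b2 b4 = 1" "s b2 b5 = 1" "s b2 b6 = 1" "s b3 b4 = 1" "s b3 b5 = 1" "s b3 b6 = -1"
    "s b4 b5 = 1" "s b4 b6 = 1" "s b5 b6 = -1"
  shows "\<exists>b. L6_labelling s b \<and> b ` {1..6} = {b1, b2, b3, b4, b5, b6}"
proof (intro exI conjI)
  \<comment> \<open>Labels start at 1, list positions at 0.\<close>
  let ?b = "\<lambda>p. [b1, b2, b3, b4, b5, b6] ! (p - 1)"
  show "L6_labelling s ?b"
    unfolding L6_labelling_iff[OF assms(1)] using assms(2-) by simp
  show "?b ` {1..6} = {b1, b2, b3, b4, b5, b6}"
    unfolding atLeastAtMost_1_6 by simp
qed

lemma principal_minor_L6:
  assumes "skew s" "L6_labelling s b"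
  shows "principal_minor s [b 1, b 2, b 3, b 4, b 5, b 6] = 25"
  using assms(2) unfolding L6_labelling_iff[OF assms(1)]
  by (subst principal_minor_6[OF assms(1)]) (simp_all add: pf6_def pf4_def)

context sign_tournament
begin

lemma four_vertex_twin:
  assumes dist: "distinct [a, b, c, d]" and V: "{a, b, c, d} \<subseteq> V" and nine: "principal_minor s [a, b, c, d] = 9"
    and v: "v \<in> V - {a, b, c, d}"
  shows "\<exists>i\<in>{a, b, c, d}. \<exists>e\<in>{1, -1}. \<forall>k\<in>{a, b, c, d} - {i}. s v k = e * s i k"
proof -
  have signs: "s a b \<in> {1, -1}" "s a c \<in> {1, -1}" "s a d \<in> {1, -1}" "s b c \<in> {1, -1}" "s b d \<in> {1, -1}"
    "s c d \<in> {1, -1}" "s v a \<in> {1, -1}" "s v b \<in> {1, -1}" "s v c \<in> {1, -1}" "s v d \<in> {1, -1}"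
    using dist V v by (intro sign; simp)+
  have "\<bar>s a b * s c d - s a c * s b d + s a d * s b c\<bar> = 3"
    using nine power2_eq_iff[of "pf4 s a b c d" 3]
    unfolding principal_minor_4[OF skew] by (auto simp: pf4_def)
  then obtain e where e: "e \<in> {1, -1}" and
    *: "s v b = e * s a b \<and> s v c = e * s a c \<and> s v d = e * s a d \<or>
      s v a = - e * s a b \<and> s v c = e * s b c \<and> s v d = e * s b d \<or>
      s v a = - e * s a c \<and> s v b = - e * s b c \<and> s v d = e * s c d \<or>
      s v a = - e * s a d \<and> s v b = - e * s b d \<and> s v c = - e * s c d"
    using four_vertex_column[OF signs(1-6) _ signs(7-10)] by blast
  have sk: "s b a = - s a b" "s c a = - s a c" "s d a = - s a d" "s c b = - s b c" "s d b = - s b d" "s d c = - s c d"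
    by (rule skewD[OF skew])+
  from * show ?thesis
  proof (elim disjE)
    assume "s v b = e * s a b \<and> s v c = e * s a c \<and> s v d = e * s a d"
    then show ?thesis using e by (intro bexI[of _ a] bexI[of _ e]) auto
  next
    assume "s v a = - e * s a b \<and> s v c = e * s b c \<and> s v d = e * s b d"
    then show ?thesis using e sk by (intro bexI[of _ b] bexI[of _ e]) auto
  next
    assume "s v a = - e * s a c \<and> s v b = - e * s b c \<and> s v d = e * s c d"
    then show ?thesis using e sk by (intro bexI[of _ c] bexI[of _ e]) auto
  next
    assume "s v a = - e * s a d \<and> s v b = - e * s b d \<and> s v c = - e * s c d"
    then show ?thesis using e sk by (intro bexI[of _ d] bexI[of _ e]) auto
  qed
qed

lemma L6_twin:
  assumes "minors_le 25 V s" and b: "L6_labelling s b" "b ` {1..6} \<subseteq> V" and v: "v \<in> V - b ` {1..6}"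
  shows "\<exists>i\<in>b ` {1..6}. \<exists>e\<in>{1, -1}. \<forall>k\<in>b ` {1..6} - {i}. s v k = e * s i k"
proof -
  note lab = b(1)[unfolded L6_labelling_iff[OF skew]]
  have dist: "distinct [b 1, b 2, b 3, b 4, b 5, b 6]" and V: "b 1 \<in> V" "b 2 \<in> V" "b 3 \<in> V" "b 4 \<in> V" "b 5 \<in> V" "b 6 \<in> V"
    and v': "v \<in> V" "v \<noteq> b 1" "v \<noteq> b 2" "v \<noteq> b 3" "v \<noteq> b 4" "v \<noteq> b 5" "v \<noteq> b 6"
    using lab b(2) v unfolding atLeastAtMost_1_6 by auto
  have x: "s v (b 1) \<in> {1, -1}" "s v (b 2) \<in> {1, -1}" "s v (b 3) \<in> {1, -1}" "s v (b 4) \<in> {1, -1}"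
    "s v (b 5) \<in> {1, -1}" "s v (b 6) \<in> {1, -1}"
    using sign v' V by blast+
  have pf: "\<bar>pf6 s v p q r t u\<bar> \<le> 5" if "distinct [v, p, q, r, t, u]" "{p, q, r, t, u} \<subseteq> V" for p q r t u
  proof -
    have "(pf6 s v p q r t u)\<^sup>2 \<le> 25"
      using minors_leD[OF assms(1) that(1)] that v' sign[of v p]
      by (simp add: principal_minor_6[OF skew])
    then show ?thesis using abs_le_square_iff[of "pf6 s v p q r t u" 5] by simp
  qed
  have "\<exists>e\<in>{1, -1}. s v (b 2) = e \<and> s v (b 3) = e \<and> s v (b 4) = e \<and> s v (b 5) = e \<and> s v (b 6) = - e \<or>
    s v (b 1) = - e \<and> s v (b 3) = e \<and> s v (b 4) = e \<and> s v (b 5) = e \<and> s v (b 6) = e \<or>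
    s v (b 1) = - e \<and> s v (b 2) = - e \<and> s v (b 4) = e \<and> s v (b 5) = e \<and> s v (b 6) = - e \<or>
    s v (b 1) = - e \<and> s v (b 2) = - e \<and> s v (b 3) = - e \<and> s v (b 5) = e \<and> s v (b 6) = e \<or>
    s v (b 1) = - e \<and> s v (b 2) = - e \<and> s v (b 3) = - e \<and> s v (b 4) = - e \<and> s v (b 6) = - e \<or>
    s v (b 1) = e \<and> s v (b 2) = - e \<and> s v (b 3) = e \<and> s v (b 4) = - e \<and> s v (b 5) = e"
  proof (rule L6_column[OF x])
    show "\<bar>- 3 * s v (b 2) + s v (b 3) + s v (b 4) - 3 * s v (b 5) + s v (b 6)\<bar> \<le> 5"
      using pf[of "b 2" "b 3" "b 4" "b 5" "b 6"] lab V v' by (simp add: pf6_def pf4_def algebra_simps)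
    show "\<bar>- 3 * s v (b 1) + 3 * s v (b 3) - s v (b 4) - s v (b 5) + s v (b 6)\<bar> \<le> 5"
      using pf[of "b 1" "b 3" "b 4" "b 5" "b 6"] lab V v' by (simp add: pf6_def pf4_def algebra_simps)
    show "\<bar>- s v (b 1) + 3 * s v (b 2) - 3 * s v (b 4) + s v (b 5) + s v (b 6)\<bar> \<le> 5"
      using pf[of "b 1" "b 2" "b 4" "b 5" "b 6"] lab V v' by (simp add: pf6_def pf4_def algebra_simps)
    show "\<bar>s v (b 1) + s v (b 2) - 3 * s v (b 3) + 3 * s v (b 5) + s v (b 6)\<bar> \<le> 5"
      using pf[of "b 1" "b 2" "b 3" "b 5" "b 6"] lab V v' by (simp add: pf6_def pf4_def algebra_simps)
    show "\<bar>3 * s v (b 1) - s v (b 2) - s v (b 3) + 3 * s v (b 4) + s v (b 6)\<bar> \<le> 5"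
      using pf[of "b 1" "b 2" "b 3" "b 4" "b 6"] lab V v' by (simp add: pf6_def pf4_def algebra_simps)
  qed
  then obtain e where e: "e \<in> {1, -1}" and
    cases: "s v (b 2) = e \<and> s v (b 3) = e \<and> s v (b 4) = e \<and> s v (b 5) = e \<and> s v (b 6) = - e \<or>
    s v (b 1) = - e \<and> s v (b 3) = e \<and> s v (b 4) = e \<and> s v (b 5) = e \<and> s v (b 6) = e \<or>
    s v (b 1) = - e \<and> s v (b 2) = - e \<and> s v (b 4) = e \<and> s v (b 5) = e \<and> s v (b 6) = - e \<or>
    s v (b 1) = - e \<and> s v (b 2) = - e \<and> s v (b 3) = - e \<and> s v (b 5) = e \<and> s v (b 6) = e \<or>
    s v (b 1) = - e \<and> s v (b 2) = - e \<and> s v (b 3) = - e \<and> s v (b 4) = - e \<and> s v (b 6) = - e \<or>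
    s v (b 1) = e \<and> s v (b 2) = - e \<and> s v (b 3) = e \<and> s v (b 4) = - e \<and> s v (b 5) = e" ..
  \<comment> \<open>The \<open>p\<close>-th alternative says that the column is \<open>e\<close>
    times row \<open>p\<close> of L6 away from the diagonal, so \<open>b p\<close> is the
    twin.\<close>
  have twin: ?thesis if p: "p \<in> {1..6}" and "\<forall>q\<in>{1, 2, 3, 4, 5, 6}. q \<noteq> p \<longrightarrow> s v (b q) = e * arc_sign (L_tournament 6) p q" for p
  proof (intro bexI[of _ "b p"] bexI[of _ e] ballI)
    fix k assume "k \<in> b ` {1..6} - {b p}"
    then obtain q where q: "k = b q" "q \<in> {1..6}" "q \<noteq> p" by blast
    then show "s v k = e * s (b p) k"
      using that b(1) unfolding L6_labelling_def atLeastAtMost_1_6 by metis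
  qed (use p e in auto)
  note L = arc_sign_def L_tournament_arc_iff
  from cases show ?thesis
  proof (elim disjE)
    assume "s v (b 2) = e \<and> s v (b 3) = e \<and> s v (b 4) = e \<and> s v (b 5) = e \<and> s v (b 6) = - e"
    then show ?thesis by (intro twin[of 1]) (simp_all add: L)
  next
    assume "s v (b 1) = - e \<and> s v (b 3) = e \<and> s v (b 4) = e \<and> s v (b 5) = e \<and> s v (b 6) = e"
    then show ?thesis by (intro twin[of 2]) (simp_all add: L)
  next
    assume "s v (b 1) = - e \<and> s v (b 2) = - e \<and> s v (b 4) = e \<and> s v (b 5) = e \<and> s v (b 6) = - e"
    then show ?thesis by (intro twin[of 3]) (simp_all add: L)
  next
    assume "s v (b 1) = - e \<and> s v (b 2) = - e \<and> s v (b 3) = - e \<and> s v (b 5) = e \<and> s v (b 6) = e"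
    then show ?thesis by (intro twin[of 4]) (simp_all add: L)
  next
    assume "s v (b 1) = - e \<and> s v (b 2) = - e \<and> s v (b 3) = - e \<and> s v (b 4) = - e \<and> s v (b 6) = - e"
    then show ?thesis by (intro twin[of 5]) (simp_all add: L)
  next
    assume "s v (b 1) = e \<and> s v (b 2) = - e \<and> s v (b 3) = e \<and> s v (b 4) = - e \<and> s v (b 5) = e"
    then show ?thesis by (intro twin[of 6]) (simp_all add: L)
  qed
qed

end


section \<open>Finding \<open>L\<^sub>6\<close> and its blowup\<close>

text \<open>Normal form of a bad pair: \<open>i\<close> is a source over the cycle
  \<open>j, k, l\<close>, while \<open>v\<close> copies \<open>i\<close> and \<open>w\<close> copies
  \<open>j\<close>, with the arc between them reversed. Only \<open>s v i\<close> and
  \<open>s w j\<close> are free.\<close>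

lemma bad_pair_L6_standard:
  assumes "skew s" and dist: "distinct [i, j, k, l, v, w]"
    and base: "s i j = 1" "s i k = 1" "s i l = 1" "s j k = 1" "s k l = 1" "s l j = 1"
    and v: "s v j = 1" "s v k = 1" "s v l = 1" "s v i \<in> {1, -1}"
    and w: "s w i = -1" "s w k = 1" "s w l = -1" "s w j \<in> {1, -1}"
    and vw: "s v w = -1" and le: "principal_minor s [i, j, k, l, v, w] \<le> 25"
  shows "\<exists>e b. (\<forall>x. e x \<in> {1, -1}) \<and> L6_labelling (switched e s) b \<and> b ` {1..6} = {i, j, k, l, v, w}"
proof -
  have sk: "s j l = - s l j" "s i v = - s v i" "s i w = - s w i" "s j v = - s v j" "s j w = - s w j"
    "s k v = - s v k" "s k w = - s w k" "s l v = - s v l" "s l w = - s w l" "s w v = - s v w"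
    "s k j = - s j k" "s l k = - s k l"
    by (rule skewD[OF assms(1)])+
  have "(pf6 s i j k l v w)\<^sup>2 \<le> 25"
    using le base(1) by (simp add: principal_minor_6[OF assms(1)])
  \<comment> \<open>The Pfaffian is \<open>- 6 - s v i * s w j\<close>, so equal signs would give
    the minor 49.\<close>
  then consider "s v i = 1" "s w j = -1" | "s v i = -1" "s w j = 1"
    using v(4) w(4) by (auto simp: pf6_def pf4_def sk base v(1-3) w(1-3) vw)
  then show ?thesis
  proof cases
    case 1
    \<comment> \<open>After switching \<open>v\<close> and \<open>k\<close>, the order
      \<open>i, l, j, v, w\<close> is transitive and \<open>k\<close> alternates along it.\<close>
    define e :: "'a \<Rightarrow> int" where "e = (\<lambda>x. if x = v \<or> x = k then -1 else 1)"
    have "\<exists>b. L6_labelling (switched e s) b \<and> b ` {1..6} = {i, l, j, v, w, k}"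
      by (rule L6_labelling_nth[OF skew_switched[OF assms(1)]])
        (use dist 1 in \<open>auto simp: switched_def e_def sk base v(1-3) w(1-3) vw\<close>)
    moreover have "{i, l, j, v, w, k} = {i, j, k, l, v, w}" by auto
    moreover have "\<forall>x. e x \<in> {1, -1}" by (simp add: e_def)
    ultimately show ?thesis by metis
  next
    case 2
    \<comment> \<open>Here the transitive order is \<open>i, w, v, j, k\<close>, with
      \<open>l\<close> alternating after its switch.\<close>
    define e :: "'a \<Rightarrow> int" where "e = (\<lambda>x. if x = l then -1 else 1)"
    have "\<exists>b. L6_labelling (switched e s) b \<and> b ` {1..6} = {i, w, v, j, k, l}"
      by (rule L6_labelling_nth[OF skew_switched[OF assms(1)]])
        (use dist 2 in \<open>auto simp: switched_def e_def sk base v(1-3) w(1-3) vw\<close>)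
    moreover have "{i, w, v, j, k, l} = {i, j, k, l, v, w}" by auto
    moreover have "\<forall>x. e x \<in> {1, -1}" by (simp add: e_def)
    ultimately show ?thesis by metis
  qed
qed

context sign_tournament
begin

lemma bad_pair_L6:
  assumes le: "minors_le 25 V s" and dist: "distinct [i, j, k, l, v, w]" and V: "{i, j, k, l, v, w} \<subseteq> V"
    and nine: "principal_minor s [i, j, k, l] = 9"
    and v: "s v j = s i j" "s v k = s i k" "s v l = s i l"
    and w: "s w i = s j i" "s w k = s j k" "s w l = s j l" and vw: "s v w = - s i j"
  shows "\<exists>e b. (\<forall>x. e x \<in> {1, -1}) \<and> L6_labelling (switched e s) b \<and> b ` {1..6} = {i, j, k, l, v, w}"
proof -
  \<comment> \<open>This makes \<open>i\<close> a source of the 4-set; \<open>w\<close> gets the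
    sign of \<open>j\<close> and \<open>v\<close> that of \<open>i\<close>, so they remain
    twins.\<close>
  define e where "e = (\<lambda>x. if x = j \<or> x = w then s i j else if x = k then s i k else if x = l then s i l else 1)"
  have signs: "s i j \<in> {1, -1}" "s i k \<in> {1, -1}" "s i l \<in> {1, -1}" "s j k \<in> {1, -1}" "s j l \<in> {1, -1}" "s k l \<in> {1, -1}"
    using dist V by (intro sign; simp)+
  then have e: "e x \<in> {1, -1}" for x by (simp add: e_def)
  interpret sw: sign_tournament V "switched e s" by (rule sign_tournament_switched[OF e])
  let ?s = "switched e s"
  have sq: "s i j * s i j = 1" "s i k * s i k = 1" "s i l * s i l = 1" using signs(1-3) by auto
  have ev: "e i = 1" "e j = s i j" "e k = s i k" "e l = s i l" "e v = 1" "e w = s i j"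
    using dist by (auto simp: e_def)
  have base: "?s i j = 1" "?s i k = 1" "?s i l = 1" "?s v j = 1" "?s v k = 1" "?s v l = 1" "?s v w = -1"
    "?s w k = ?s j k" "?s w l = ?s j l"
    unfolding switched_def ev v w vw using sq by simp_all
  have wi: "?s w i = -1"
    unfolding switched_def ev w skewD[OF skew, of j i] using sq by simp
  have signs': "?s j k \<in> {1, -1}" "?s j l \<in> {1, -1}" "?s k l \<in> {1, -1}" "?s v i \<in> {1, -1}" "?s w j \<in> {1, -1}"
    using dist V by (intro sw.sign; auto)+
  have "(pf4 ?s i j k l)\<^sup>2 = 9"
    using nine by (simp flip: principal_minor_4[OF sw.skew] add: principal_minor_switched[OF e])
  then have "\<bar>?s k l - ?s j l + ?s j k\<bar> = 3"
    using power2_eq_iff[of "pf4 ?s i j k l" 3] by (auto simp: pf4_def base)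
  \<comment> \<open>Three signs with sum \<plusminus>3 agree, so \<open>j, k, l\<close> is a cycle
    in one of the two directions; the second is handled by exchanging \<open>k\<close> and
    \<open>l\<close>.\<close>
  then consider "?s j k = 1" "?s k l = 1" "?s j l = -1" | "?s j k = -1" "?s k l = -1" "?s j l = 1"
    using signs'(1-3) by auto
  then have "\<exists>e' b. (\<forall>x. e' x \<in> {1, -1}) \<and> L6_labelling (switched e' ?s) b \<and> b ` {1..6} = {i, j, k, l, v, w}"
  proof cases
    case 1
    have le25: "principal_minor ?s [i, j, k, l, v, w] \<le> 25"
      unfolding principal_minor_switched[OF e] by (rule minors_leD[OF le dist]) (use V in simp)
    have arcs: "?s l j = 1" "?s w k = 1" "?s w l = -1"
      using 1 base(8,9) skewD[OF sw.skew, of l j] by simp_all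
    show ?thesis
      by (rule bad_pair_L6_standard[OF sw.skew dist base(1-3) 1(1,2) arcs(1) base(4-6) signs'(4) wi arcs(2,3)
            signs'(5) base(7) le25])
  next
    case 2
    have dist': "distinct [i, j, l, k, v, w]" using dist by auto
    have le25: "principal_minor ?s [i, j, l, k, v, w] \<le> 25"
      unfolding principal_minor_switched[OF e] by (rule minors_leD[OF le dist']) (use V in simp)
    have arcs: "?s l k = 1" "?s k j = 1" "?s w l = 1" "?s w k = -1"
      using 2 base(8,9) skewD[OF sw.skew, of k j] skewD[OF sw.skew, of l k] by simp_all
    have "\<exists>e' b. (\<forall>x. e' x \<in> {1, -1}) \<and> L6_labelling (switched e' ?s) b \<and> b ` {1..6} = {i, j, l, k, v, w}"
      by (rule bad_pair_L6_standard[OF sw.skew dist' base(1,3,2) 2(3) arcs(1,2) base(4,6,5) signs'(4) wi arcs(3,4)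
            signs'(5) base(7) le25])
    moreover have "{i, j, l, k, v, w} = {i, j, k, l, v, w}" by auto
    ultimately show ?thesis by simp
  qed
  then obtain e' b where e': "\<forall>x. e' x \<in> {1, -1}" and "L6_labelling (switched e' ?s) b" "b ` {1..6} = {i, j, k, l, v, w}"
    by blast
  moreover have "e' x * e x \<in> {1, -1}" for x using e[of x] e'[rule_format, of x] by auto
  ultimately show ?thesis
    unfolding switched_switched by (intro exI[of _ "\<lambda>x. e' x * e x"] exI[of _ b]) simp
qed

lemma ex_L6:
  assumes le: "minors_le 25 V s" and "\<not> minors_le 9 V s"
  shows "\<exists>e b. (\<forall>x. e x \<in> {1, -1}) \<and> L6_labelling (switched e s) b \<and> b ` {1..6} \<subseteq> V"
proof -
  obtain p q r t where pqrt: "distinct [p, q, r, t]" "{p, q, r, t} \<subseteq> V" "principal_minor s [p, q, r, t] = 9"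
    using minors_le_9_if_no_9 assms(2) by blast
  let ?B = "{p, q, r, t}"
  obtain e c where e: "\<And>x. e x \<in> {1, -1}" and tb: "twin_base V (switched e s) ?B c"
    using ex_twin_base[OF pqrt(2) four_vertex_twin[OF pqrt]] by blast
  interpret tb: twin_base V "switched e s" ?B c by (rule tb)
  let ?s = "switched e s"
  have le': "minors_le 25 V ?s" "\<not> minors_le 9 V ?s" using assms by (simp_all add: minors_le_switched[OF e])
  have nine: "principal_minor ?s [p, q, r, t] = 9" using pqrt(3) by (simp add: principal_minor_switched[OF e])
  have "\<exists>v\<in>V. \<exists>w\<in>V. c v \<noteq> c w \<and> ?s v w \<noteq> ?s (c v) (c w)"
  proof (rule ccontr)
    assume no_bad: "\<not> (\<exists>v\<in>V. \<exists>w\<in>V. c v \<noteq> c w \<and> ?s v w \<noteq> ?s (c v) (c w))"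
    \<comment> \<open>A cyclic triple would give a minor 9 * 9 > 25.\<close>
    have "\<not> (?s u v = 1 \<and> ?s v w = 1 \<and> ?s w u = 1)"
      if "u \<in> V" "v \<in> V" "w \<in> V" "c u = c v" "c v = c w" for u v w
      by (rule tb.no_cyclic_class[OF le'(1) pqrt(1) _ _ that]) (use nine in auto)
    with no_bad have cl: "transitive_classes ?s c V ?s" unfolding transitive_classes_def by blast
    \<comment> \<open>There are at most four classes, so every minor reduces to one of order at most
      four, against the minor above 9.\<close>
    have "principal_minor ?s vs \<le> 9" if vs: "distinct vs" "set vs \<subseteq> V" for vs
    proof -
      obtain ws where ws: "distinct ws" "set ws \<subseteq> set vs" "inj_on c (set ws)"
        "principal_minor ?s vs = principal_minor ?s ws"
        using tb.transversal_principal_minor[OF cl vs] by blast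
      have "c ` set ws \<subseteq> ?B" using ws vs tb.rep_in by blast
      then have "card (set ws) \<le> card ?B" by (intro card_inj_on_le[OF ws(3)]) auto
      moreover have "card ?B = 4" using pqrt(1) by simp
      ultimately have "length ws \<le> 5" using ws(1) by (simp add: distinct_card)
      then show ?thesis using tb.principal_minor_le_9[of ws] ws vs by simp
    qed
    then show False using le'(2) unfolding minors_le_def by blast
  qed
  then obtain v w where vw: "v \<in> V" "w \<in> V" "c v \<noteq> c w" "?s v w \<noteq> ?s (c v) (c w)" by blast
  \<comment> \<open>The two base vertices that do not represent the bad pair.\<close>
  obtain rest where rest: "set rest = ?B - {c v, c w}" "distinct rest"
    using finite_distinct_list[of "?B - {c v, c w}"] by auto
  have cB: "c v \<in> ?B" "c w \<in> ?B" using tb.rep_in vw by auto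
  have "length rest = card (?B - {c v, c w})" using rest by (simp flip: distinct_card)
  also have "\<dots> = card ?B - card {c v, c w}" using cB by (intro card_Diff_subset) auto
  also have "\<dots> = 2" using pqrt(1) vw(3) by simp
  finally obtain k l where kl: "rest = [k, l]" by (auto simp: length_Suc_conv numeral_eq_Suc)
  have B: "{c v, c w, k, l} = ?B" using cB rest(1) kl by auto
  have k: "k \<in> ?B" "k \<noteq> c v" "k \<noteq> c w" and l: "l \<in> ?B" "l \<noteq> c v" "l \<noteq> c w" and "k \<noteq> l"
    using rest kl by auto
  note bad = tb.bad_pair[OF vw]
  have vw_ne: "v \<noteq> w" using vw(3) by auto
  have "x \<noteq> v" "x \<noteq> w" if "x \<in> ?B" for x using that bad(1,2) by auto
  note this[OF cB(1)] this[OF cB(2)] this[OF k(1)] this[OF l(1)]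
  then have dist: "distinct [c v, c w, k, l, v, w]"
    using k(2,3) l(2,3) \<open>k \<noteq> l\<close> vw(3) vw_ne by simp
  have "distinct [c v, c w, k, l]" using dist by simp
  then have nine': "principal_minor ?s [c v, c w, k, l] = 9"
    using nine B pqrt(1) principal_minor_set_cong[of "[p, q, r, t]" "[c v, c w, k, l]" ?s] by simp
  have tw: "?s v (c w) = ?s (c v) (c w)" "?s v k = ?s (c v) k" "?s v l = ?s (c v) l"
    "?s w (c v) = ?s (c w) (c v)" "?s w k = ?s (c w) k" "?s w l = ?s (c w) l"
    using k l cB vw by (intro tb.twin; simp)+
  have V': "{c v, c w, k, l, v, w} \<subseteq> V" using vw(1,2) tb.base B by blast
  obtain e' b where e': "\<forall>x. e' x \<in> {1, -1}" and b: "L6_labelling (switched e' ?s) b" "b ` {1..6} = {c v, c w, k, l, v, w}"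
    using tb.bad_pair_L6[OF le'(1) dist V' nine' tw bad(3)] by blast
  moreover have "e' x * e x \<in> {1, -1}" for x using e[of x] e'[rule_format, of x] by auto
  moreover have "b ` {1..6} \<subseteq> V" using b(2) vw(1,2) B tb.base by blast
  ultimately show ?thesis
    unfolding switched_switched by (intro exI[of _ "\<lambda>x. e' x * e x"] exI[of _ b]) simp
qed

lemma L6_transitive_classes:
  assumes le: "minors_le 25 V s" and b: "L6_labelling s b" "b ` {1..6} \<subseteq> V"
  shows "\<exists>e c. (\<forall>x. e x \<in> {1, -1}) \<and> L6_labelling (switched e s) b \<and>
    twin_base V (switched e s) (b ` {1..6}) c \<and> transitive_classes (switched e s) c V (switched e s)"
proof -
  let ?B = "b ` {1..6}"
  obtain e c where e: "\<And>x. e x \<in> {1, -1}" and eB: "\<forall>x\<in>?B. e x = 1" and tb: "twin_base V (switched e s) ?B c"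
    using ex_twin_base[OF b(2) L6_twin[OF le b]] by blast
  interpret tb: twin_base V "switched e s" ?B c by (rule tb)
  let ?s = "switched e s" and ?bs = "[b 1, b 2, b 3, b 4, b 5, b 6]"
  have le': "minors_le 25 V ?s" using le by (simp add: minors_le_switched[OF e])
  \<comment> \<open>The switching is trivial on the base, so the labelling survives.\<close>
  have lab: "L6_labelling ?s b"
    using b(1) eB unfolding L6_labelling_def by (auto simp: switched_def)
  have bs: "distinct ?bs" "set ?bs = ?B" "principal_minor ?s ?bs = 25"
    using lab principal_minor_L6[OF tb.skew lab] unfolding L6_labelling_iff[OF tb.skew] atLeastAtMost_1_6 by auto
  have cyc: "\<not> (?s u v = 1 \<and> ?s v w = 1 \<and> ?s w u = 1)"
    if "u \<in> V" "v \<in> V" "w \<in> V" "c u = c v" "c v = c w" for u v w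
    by (rule tb.no_cyclic_class[OF le' bs(1,2) _ that]) (use bs(3) in simp)
  have no_bad: "?s v w = ?s (c v) (c w)" if vw: "v \<in> V" "w \<in> V" "c v \<noteq> c w" for v w
  proof (rule ccontr)
    assume "?s v w \<noteq> ?s (c v) (c w)"
    note bad = tb.bad_pair[OF vw this]
    obtain rest where rest: "set rest = ?B - {c v, c w}" "distinct rest"
      using finite_distinct_list[of "?B - {c v, c w}"] by auto
    have cB: "c v \<in> ?B" "c w \<in> ?B" using tb.rep_in vw by auto
    have "length rest = card (?B - {c v, c w})" using rest by (simp flip: distinct_card)
    also have "\<dots> = card ?B - card {c v, c w}" using cB by (intro card_Diff_subset) auto
    also have "\<dots> = 4" using distinct_card[OF bs(1)] vw(3) unfolding bs(2) by simp
    finally obtain k l m n where klmn: "rest = [k, l, m, n]" by (auto simp: length_Suc_conv numeral_eq_Suc)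
    have B: "set [k, l, m, n, c v, c w] = ?B" using cB rest(1) klmn by auto
    have dist: "distinct [k, l, m, n, c v, c w]" using rest klmn vw(3) by auto
    have in_B: "k \<in> ?B" "l \<in> ?B" "m \<in> ?B" "n \<in> ?B" using rest(1) klmn by auto
    then have in_V: "k \<in> V" "l \<in> V" "m \<in> V" "n \<in> V" "c v \<in> V" "c w \<in> V" using cB tb.base by auto
    have ne: "v \<notin> set [k, l, m, n, c v, c w]" "w \<notin> set [k, l, m, n, c v, c w]" "v \<noteq> w"
      using bad(1,2) vw(3) unfolding B by auto
    have unit: "?s v (c v) \<in> {1, -1}" "?s k l \<in> {1, -1}" "?s (c v) (c w) \<in> {1, -1}" "?s w (c w) \<in> {1, -1}"
      using in_V vw(1,2) dist ne by (intro tb.sign; auto)+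
    have "(pf6 ?s k l m n (c v) (c w))\<^sup>2 = principal_minor ?s [k, l, m, n, c v, c w]"
      by (rule principal_minor_6[OF tb.skew unit(2), symmetric])
    also have "\<dots> = 25"
      using principal_minor_set_cong[OF bs(1) dist] B bs(2,3) by metis
    finally have "pf6 ?s k l m n (c v) (c w) \<in> {5, -5}"
      using power2_eq_iff[of "pf6 ?s k l m n (c v) (c w)" 5] by simp
    moreover have "principal_minor ?s [k, l, m, n] \<le> 9"
      using in_V dist by (intro tb.principal_minor_le_9) auto
    then have "\<bar>pf4 ?s k l m n\<bar> \<le> 3"
      using abs_le_square_iff[of "pf4 ?s k l m n" 3] by (simp add: principal_minor_4[OF tb.skew])
    \<comment> \<open>The term with \<open>pf6\<close> is 10 and the other at most 3 in absolute
      value, so the sum is at least 7.\<close>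
    ultimately have "5 < \<bar>?s w (c w) * pf4 ?s k l m n + 2 * ?s v (c v) * ?s (c v) (c w) * pf6 ?s k l m n (c v) (c w)\<bar>"
      using unit(1,3,4) by auto
    moreover have "principal_minor ?s [v, c v, k, l, m, n, w, c w] =
      (?s w (c w) * pf4 ?s k l m n + 2 * ?s v (c v) * ?s (c v) (c w) * pf6 ?s k l m n (c v) (c w))\<^sup>2"
    proof (rule principal_minor_bad_pair[OF tb.skew unit(1-3) _ _ _ _ _ _ _ _ _ _ bad(3)])
      show "?s v k = ?s (c v) k" "?s v l = ?s (c v) l" "?s v m = ?s (c v) m" "?s v n = ?s (c v) n" "?s v (c w) = ?s (c v) (c w)"
        using in_B cB dist vw by (intro tb.twin; auto)+
      show "?s w k = ?s (c w) k" "?s w l = ?s (c w) l" "?s w m = ?s (c w) m" "?s w n = ?s (c w) n" "?s w (c v) = ?s (c w) (c v)"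
        using in_B cB dist vw by (intro tb.twin; auto)+
    qed
    moreover have "principal_minor ?s [v, c v, k, l, m, n, w, c w] \<le> 25"
      using in_V vw dist ne by (intro minors_leD[OF le']) auto
    ultimately show False
      using abs_le_square_iff[of "?s w (c w) * pf4 ?s k l m n + 2 * ?s v (c v) * ?s (c v) (c w) * pf6 ?s k l m n (c v) (c w)" 5]
      by simp
  qed
  have "transitive_classes ?s c V ?s"
    unfolding transitive_classes_def using no_bad cyc by blast
  then show ?thesis using e lab tb by (intro exI[of _ e] exI[of _ c]) simp
qed

end


section \<open>Digraphs\<close>

lemma tournament_parcs:
  assumes "tournament T" "(u, v) \<in> parcs T"
  shows "u \<in> pverts T" "v \<in> pverts T" "u \<noteq> v" "(v, u) \<notin> parcs T"
proof -
  interpret pair_digraph T using assms(1) by (simp add: tournament_def)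
  show V: "u \<in> pverts T" "v \<in> pverts T" and "u \<noteq> v"
    using assms(2) wellformed[of "(u, v)"] no_loops[of "(u, v)"] by auto
  then show "(v, u) \<notin> parcs T" using assms unfolding tournament_def by blast
qed

lemma arc_sign_eq_1_iff: "arc_sign T u v = 1 \<longleftrightarrow> (u, v) \<in> parcs T"
  by (simp add: arc_sign_def)

lemma sign_tournament_arc_sign:
  assumes "tournament T"
  shows "sign_tournament (pverts T) (arc_sign T)"
proof
  interpret pair_digraph T using assms by (simp add: tournament_def)
  show "finite (pverts T)" by (rule pair_finite_verts)
  show "skew (arc_sign T)"
    unfolding skew_def arc_sign_def by (auto dest: tournament_parcs(4)[OF assms])
  fix u v assume "u \<in> pverts T" "v \<in> pverts T" "u \<noteq> v"
  then have "(u, v) \<in> parcs T \<or> (v, u) \<in> parcs T" using assms unfolding tournament_def by blast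
  then show "arc_sign T u v \<in> {1, -1}" by (auto simp: arc_sign_def)
qed

lemma tournament_det_subtournament:
  assumes "distinct vs" "set vs = X"
  shows "tournament_det (subtournament T X) = principal_minor (arc_sign T) vs"
proof -
  have "tournament_det (subtournament T X) = principal_minor (arc_sign (subtournament T X)) vs"
    using assms
    by (subst tournament_det_eq[of vs]) (simp_all add: subtournament_def skew_adjacency_mat_def principal_minor_def arc_sign_def)
  also have "\<dots> = principal_minor (arc_sign T) vs"
    by (rule principal_minor_cong) (use assms in \<open>auto simp: arc_sign_def subtournament_def\<close>)
  finally show ?thesis .
qed

text \<open>Vertex sets are enumerated by lists. The empty list belongs to no subtournament; its
  minor 1 is within the bound because of \<open>0 < k\<close>.\<close>

lemma D_class_iff_minors_le:
  assumes "tournament T" "0 < k"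
  shows "T \<in> D_class k \<longleftrightarrow> minors_le ((int k)\<^sup>2) (pverts T) (arc_sign T)"
proof
  assume T: "T \<in> D_class k"
  show "minors_le ((int k)\<^sup>2) (pverts T) (arc_sign T)"
    unfolding minors_le_def
  proof (intro allI impI)
    fix vs assume vs: "distinct vs" "set vs \<subseteq> pverts T"
    show "principal_minor (arc_sign T) vs \<le> (int k)\<^sup>2"
    proof (cases "vs = []")
      case True
      then show ?thesis using assms(2) by simp
    next
      case False
      then show ?thesis
        using T vs tournament_det_subtournament[OF vs(1) refl, of T] by (auto simp: D_class_def)
    qed
  qed
next
  assume le: "minors_le ((int k)\<^sup>2) (pverts T) (arc_sign T)"
  interpret sign_tournament "pverts T" "arc_sign T" by (rule sign_tournament_arc_sign[OF assms(1)])
  have "tournament_det (subtournament T X) \<le> (int k)\<^sup>2" if X: "X \<subseteq> pverts T" for X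
  proof -
    obtain vs where vs: "set vs = X" "distinct vs"
      using finite_distinct_list[of X] finite_subset[OF X finite_V] by auto
    then show ?thesis
      using minors_leD[OF le, of vs] X by (simp add: tournament_det_subtournament[OF vs(2,1)])
  qed
  then show "T \<in> D_class k" using assms(1) by (simp add: D_class_def)
qed

section \<open>Switching of digraphs\<close>

lemma parcs_switch_iff:
  "(u, v) \<in> parcs (switch T W) \<longleftrightarrow> (if u \<in> W \<longleftrightarrow> v \<in> W then (u, v) \<in> parcs T else (v, u) \<in> parcs T)"
  by (auto simp: switch_def)

lemma arc_sign_switch:
  assumes "tournament T"
  shows "arc_sign (switch T W) = switched (\<lambda>x. if x \<in> W then -1 else 1) (arc_sign T)"
proof (intro ext)
  fix u v
  show "arc_sign (switch T W) u v = switched (\<lambda>x. if x \<in> W then -1 else 1) (arc_sign T) u v"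
    unfolding arc_sign_def switched_def parcs_switch_iff by (auto dest: tournament_parcs(4)[OF assms])
qed

lemma pverts_switch [simp]: "pverts (switch T W) = pverts T"
  by (simp add: switch_def)

lemma tournament_switch:
  assumes "tournament T"
  shows "tournament (switch T W)"
proof -
  interpret pair_digraph T using assms by (simp add: tournament_def)
  have arc: "u \<in> pverts T" "v \<in> pverts T" "u \<noteq> v" if "(u, v) \<in> parcs (switch T W)" for u v
    using that unfolding parcs_switch_iff by (auto dest: tournament_parcs[OF assms] split: if_splits)
  then have "parcs (switch T W) \<subseteq> pverts T \<times> pverts T" by auto
  then have "finite (parcs (switch T W))"
    by (rule finite_subset) simp
  then have "pair_digraph (switch T W)"
    by unfold_locales (auto dest: arc)
  moreover have "(u, v) \<in> parcs (switch T W) \<longleftrightarrow> (v, u) \<notin> parcs (switch T W)"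
    if "u \<in> pverts T" "v \<in> pverts T" "u \<noteq> v" for u v
  proof -
    have "(u, v) \<in> parcs T \<longleftrightarrow> (v, u) \<notin> parcs T" using assms that unfolding tournament_def by blast
    then show ?thesis unfolding parcs_switch_iff by auto
  qed
  ultimately show ?thesis unfolding tournament_def pverts_switch by blast
qed

lemma switching_equivalent_minors_le:
  assumes "tournament T" "tournament T'" "switching_equivalent T T'"
  shows "minors_le m (pverts T) (arc_sign T) \<longleftrightarrow> minors_le m (pverts T') (arc_sign T')"
  using assms(3) unfolding switching_equivalent_def
proof (elim disjE exE conjE)
  fix W assume "T' = switch T W"
  then show ?thesis by (simp add: arc_sign_switch[OF assms(1)] minors_le_switched)
next
  fix W assume "T = switch T' W"
  then show ?thesis by (simp add: arc_sign_switch[OF assms(2)] minors_le_switched)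
qed

lemma pverts_L_tournament [simp]: "pverts (L_tournament n) = {1..n}"
  by (simp add: L_tournament_def)

lemma L6_labelling_id: "L6_labelling (arc_sign (L_tournament 6)) (\<lambda>p. p)"
  by (simp add: L6_labelling_def)

text \<open>Every minor reduces to a transversal of the six blocks: five or fewer vertices give at
  most 9, six give L6 itself with 25. The latter occurs because no block is empty.\<close>

lemma blowup_L6_minors:
  assumes pos: "\<forall>v\<in>pverts (L_tournament 6). 0 < a v" and blowup: "is_transitive_blowup (L_tournament 6) a T"
  shows "minors_le 25 (pverts T) (arc_sign T)" "\<not> minors_le 9 (pverts T) (arc_sign T)"
proof -
  let ?L = "arc_sign (L_tournament 6)" and ?s = "arc_sign T"
  obtain P where tT: "tournament T" and verts: "pverts T = (\<Union>v\<in>{1..6}. P v)" and disj: "disjoint_family_on P {1..6}"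
    and cls: "\<forall>v\<in>{1..6}. card (P v) = a v \<and> transitive_tournament (subtournament T (P v))"
    and arcs: "\<forall>(v, w)\<in>parcs (L_tournament 6). P v \<times> P w \<subseteq> parcs T"
    using blowup unfolding is_transitive_blowup_def pverts_L_tournament by blast
  interpret sign_tournament "pverts T" ?s by (rule sign_tournament_arc_sign[OF tT])
  interpret L: sign_tournament "{1..6}" ?L
    using sign_tournament_arc_sign[OF tournament_L_tournament[of 6]] by simp
  have s_L: "?s u v = ?L p q" if "p \<in> {1..6}" "q \<in> {1..6}" "p \<noteq> q" "u \<in> P p" "v \<in> P q" for p q u v
  proof (cases "(p, q) \<in> parcs (L_tournament 6)")
    case True
    then have "(u, v) \<in> parcs T" using arcs that by blast
    with True show ?thesis by (simp add: arc_sign_def)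
  next
    case False
    then have "(q, p) \<in> parcs (L_tournament 6)"
      using tournament_L_tournament[of 6] that unfolding tournament_def pverts_L_tournament by blast
    moreover from this have "(v, u) \<in> parcs T" using arcs that by blast
    moreover from this have "(u, v) \<notin> parcs T" using tournament_parcs(4)[OF tT] by blast
    ultimately show ?thesis using False by (simp add: arc_sign_def)
  qed
  have "\<forall>u\<in>pverts T. \<exists>p\<in>{1..6}. u \<in> P p" using verts by blast
  then obtain c where c: "\<And>u. u \<in> pverts T \<Longrightarrow> c u \<in> {1..6} \<and> u \<in> P (c u)" by metis
  have "\<not> (?s u v = 1 \<and> ?s v w = 1 \<and> ?s w u = 1)"
    if "u \<in> pverts T" "v \<in> pverts T" "w \<in> pverts T" "c u = c v" "c v = c w" for u v w
  proof
    have "u \<in> P (c u)" "v \<in> P (c u)" "w \<in> P (c u)"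
      using c[OF that(1)] c[OF that(2)] c[OF that(3)] that(4,5) by auto
    moreover assume "?s u v = 1 \<and> ?s v w = 1 \<and> ?s w u = 1"
    ultimately have "(u, v) \<in> parcs (subtournament T (P (c u)))" "(v, w) \<in> parcs (subtournament T (P (c u)))"
      "(w, u) \<in> parcs (subtournament T (P (c u)))"
      by (simp_all add: arc_sign_eq_1_iff subtournament_def)
    then show False using cls c[OF that(1)] unfolding transitive_tournament_def by blast
  qed
  moreover have "?s u v = ?L (c u) (c v)" if "u \<in> pverts T" "v \<in> pverts T" "c u \<noteq> c v" for u v
    using s_L[of "c u" "c v" u v] c[of u] c[of v] that by blast
  ultimately have tc: "transitive_classes ?L c (pverts T) ?s" unfolding transitive_classes_def by blast
  have L25: "principal_minor ?L [1, 2, 3, 4, 5, 6] = 25"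
    using principal_minor_L6[OF L.skew L6_labelling_id] by simp
  show "minors_le 25 (pverts T) ?s"
    unfolding minors_le_def
  proof (intro allI impI)
    fix vs assume vs: "distinct vs" "set vs \<subseteq> pverts T"
    obtain ws where ws: "distinct ws" "set ws \<subseteq> set vs" "inj_on c (set ws)" "principal_minor ?s vs = principal_minor ?s ws"
      using transversal_principal_minor[OF tc vs] by blast
    have sub: "c ` set ws \<subseteq> {1..6}" using c ws(2) vs(2) by blast
    have len: "length ws = card (c ` set ws)"
      using ws(1,3) by (simp add: card_image distinct_card)
    show "principal_minor ?s vs \<le> 25"
    proof (cases "length ws \<le> 5")
      case True
      then have "principal_minor ?s ws \<le> 9" using ws(1,2) vs(2) by (intro principal_minor_le_9) auto
      then show ?thesis using ws(4) by simp
    next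
      case False
      \<comment> \<open>Six vertices now meet each block exactly once, so \<open>c\<close> maps them
        isomorphically to L6.\<close>
      have "card (c ` set ws) \<le> card {1..6::nat}" by (rule card_mono[OF _ sub]) simp
      with False len have "card (c ` set ws) = card {1..6::nat}" by simp
      then have "c ` set ws = {1..6}" using card_subset_eq[OF _ sub] by blast
      then have "principal_minor ?L (map c ws) = principal_minor ?L [1, 2, 3, 4, 5, 6]"
        using ws(1,3) unfolding atLeastAtMost_1_6 by (intro principal_minor_set_cong) (simp_all add: distinct_map)
      moreover have "principal_minor ?L (map c ws) = principal_minor ?s ws"
        unfolding principal_minor_map
      proof (rule principal_minor_cong)
        fix x y assume xy: "x \<in> set ws" "y \<in> set ws"
        show "?L (c x) (c y) = ?s x y"
        proof (cases "x = y")
          case True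
          then show ?thesis using skew_self[OF skew] skew_self[OF L.skew] by simp
        next
          case False
          then have "c x \<noteq> c y" using ws(3) xy by (auto dest: inj_onD)
          moreover have "x \<in> pverts T" "y \<in> pverts T" using xy ws(2) vs(2) by auto
          ultimately show ?thesis using transitive_classesD(1)[OF tc, of x y] by simp
        qed
      qed
      ultimately show ?thesis using ws(4) L25 by simp
    qed
  qed
  have "\<forall>p\<in>{1..6}. card (P p) \<noteq> 0" using pos cls by simp
  then have "\<forall>p\<in>{1..6}. \<exists>u. u \<in> P p" by (metis card.empty all_not_in_conv)
  \<comment> \<open>One vertex from each block; together they form a copy of L6.\<close>
  then obtain b where b: "\<And>p. p \<in> {1..6} \<Longrightarrow> b p \<in> P p" by metis
  have inj: "inj_on b {1..6}"
  proof (rule inj_onI, rule ccontr)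
    fix p q assume "p \<in> {1..6}" "q \<in> {1..6}" "b p = b q" "p \<noteq> q"
    then show False using b[of p] b[of q] disjoint_family_onD[OF disj, of p q] by auto
  qed
  have lab: "L6_labelling ?s b"
    unfolding L6_labelling_def
  proof (intro conjI ballI inj)
    fix p q :: nat assume "p \<in> {1..6}" "q \<in> {1..6}"
    then show "?s (b p) (b q) = ?L p q"
      using s_L[of p q "b p" "b q"] b[of p] b[of q] skew_self[OF skew, of "b p"] skew_self[OF L.skew, of p]
      by (cases "p = q") simp_all
  qed
  have "distinct [b 1, b 2, b 3, b 4, b 5, b 6]" using lab L6_labelling_iff[OF skew] by blast
  moreover have "b p \<in> pverts T" if "p \<in> {1..6}" for p using b[OF that] verts that by blast
  then have "set [b 1, b 2, b 3, b 4, b 5, b 6] \<subseteq> pverts T" by simp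
  ultimately have "minors_le 9 (pverts T) ?s \<Longrightarrow> principal_minor ?s [b 1, b 2, b 3, b 4, b 5, b 6] \<le> 9"
    by (intro minors_leD)
  then show "\<not> minors_le 9 (pverts T) ?s" using principal_minor_L6[OF skew lab] by linarith
qed

text \<open>One switching produces L6, a second makes all vertices twins of its vertices. Both are
  merged into a single switch, and the blocks are the fibres of \<open>c\<close>.\<close>

lemma ex_blowup_L6:
  assumes tT: "tournament T" and "minors_le 25 (pverts T) (arc_sign T)" "\<not> minors_le 9 (pverts T) (arc_sign T)"
  shows "\<exists>T' a. (\<forall>v\<in>pverts (L_tournament 6). 0 < a v) \<and>
    is_transitive_blowup (L_tournament 6) a T' \<and> switching_equivalent T T'"
proof -
  let ?V = "pverts T" and ?s = "arc_sign T"
  interpret sign_tournament ?V ?s by (rule sign_tournament_arc_sign[OF tT])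
  obtain e1 b where e1: "\<And>x. e1 x \<in> {1, -1}" and b1: "L6_labelling (switched e1 ?s) b" and bV: "b ` {1..6} \<subseteq> ?V"
    using ex_L6[OF assms(2,3)] by blast
  interpret sw: sign_tournament ?V "switched e1 ?s" by (rule sign_tournament_switched[OF e1])
  have le1: "minors_le 25 ?V (switched e1 ?s)" using assms(2) by (simp add: minors_le_switched[OF e1])
  obtain e2 c where e2: "\<forall>x. e2 x \<in> {1, -1}" and b2: "L6_labelling (switched e2 (switched e1 ?s)) b"
    and tb: "twin_base ?V (switched e2 (switched e1 ?s)) (b ` {1..6}) c"
    and tc: "transitive_classes (switched e2 (switched e1 ?s)) c ?V (switched e2 (switched e1 ?s))"
    using sw.L6_transitive_classes[OF le1 b1 bV] by blast
  \<comment> \<open>Successive switchings multiply their signs. \<open>W\<close> has to lie in the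
    vertex set, so the signs are compared on \<open>?V\<close> only.\<close>
  define W where "W = {x \<in> ?V. e2 x * e1 x = -1}"
  define T' where "T' = switch T W"
  let ?s' = "arc_sign T'"
  have s': "?s' u v = switched e2 (switched e1 ?s) u v" if "u \<in> ?V" "v \<in> ?V" for u v
  proof -
    have W: "(if x \<in> W then -1 else 1) = e2 x * e1 x" if "x \<in> ?V" for x
      using e1[of x] e2[rule_format, of x] that by (auto simp: W_def)
    show ?thesis
      unfolding T'_def arc_sign_switch[OF tT] switched_switched switched_def W[OF that(1)] W[OF that(2)] ..
  qed
  interpret tb: twin_base ?V "switched e2 (switched e1 ?s)" "b ` {1..6}" c by (rule tb)
  have T': "tournament T'" "pverts T' = ?V" by (simp_all add: T'_def tournament_switch[OF tT])
  define P where "P = (\<lambda>p. {v \<in> ?V. c v = b p})"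
  have inj: "inj_on b {1..6}" using b2 by (simp add: L6_labelling_def)
  have "is_transitive_blowup (L_tournament 6) (\<lambda>p. card (P p)) T'"
    unfolding is_transitive_blowup_def pverts_L_tournament
  proof (intro conjI exI[of _ P] ballI)
    show "pverts T' = (\<Union>p\<in>{1..6}. P p)"
    proof
      show "pverts T' \<subseteq> (\<Union>p\<in>{1..6}. P p)"
      proof
        fix v assume "v \<in> pverts T'"
        then have "v \<in> ?V" using T'(2) by simp
        moreover from this obtain p where "p \<in> {1..6}" "c v = b p" using tb.rep_in by blast
        ultimately show "v \<in> (\<Union>p\<in>{1..6}. P p)" by (auto simp: P_def)
      qed
    qed (auto simp: P_def T'(2))
    show "disjoint_family_on P {1..6}"
      unfolding disjoint_family_on_def
    proof (intro ballI impI)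
      fix p q :: nat assume "p \<in> {1..6}" "q \<in> {1..6}" "p \<noteq> q"
      then have "b p \<noteq> b q" using inj_on_eq_iff[OF inj] by simp
      then show "P p \<inter> P q = {}" by (auto simp: P_def)
    qed
  next
    fix p :: nat assume "p \<in> {1..6}"
    have "tournament (subtournament T' (P p))"
      by (rule tournament_subtournament[OF T'(1)]) (auto simp: T' P_def)
    moreover have "\<not> ((u, v) \<in> parcs (subtournament T' (P p)) \<and> (v, w) \<in> parcs (subtournament T' (P p)) \<and>
      (w, u) \<in> parcs (subtournament T' (P p)))" for u v w
    proof
      assume *: "(u, v) \<in> parcs (subtournament T' (P p)) \<and> (v, w) \<in> parcs (subtournament T' (P p)) \<and>
        (w, u) \<in> parcs (subtournament T' (P p))"
      then have uvw: "u \<in> ?V" "v \<in> ?V" "w \<in> ?V" and c: "c u = c v" "c v = c w"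
        and cyc: "?s' u v = 1" "?s' v w = 1" "?s' w u = 1"
        by (auto simp: subtournament_def P_def arc_sign_eq_1_iff)
      show False
        using transitive_classesD(2)[OF tc uvw(1,2,3) c] cyc
        unfolding s'[OF uvw(1,2)] s'[OF uvw(2,3)] s'[OF uvw(3,1)] by blast
    qed
    ultimately show "transitive_tournament (subtournament T' (P p))"
      unfolding transitive_tournament_def by blast
  next
    fix x assume "x \<in> parcs (L_tournament 6)"
    then obtain p q where x: "x = (p, q)" "(p, q) \<in> parcs (L_tournament 6)" by (cases x) auto
    then have pq: "p \<in> {1..6}" "q \<in> {1..6}" "p \<noteq> q" by (simp_all add: L_tournament_arc_iff)
    have "(u, v) \<in> parcs T'" if "u \<in> P p" "v \<in> P q" for u v
    proof -
      have uv: "u \<in> ?V" "v \<in> ?V" "c u = b p" "c v = b q" using that by (auto simp: P_def)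
      have "c u \<noteq> c v" using inj_on_eq_iff[OF inj pq(1,2)] pq(3) uv(3,4) by simp
      then have "?s' u v = switched e2 (switched e1 ?s) (b p) (b q)"
        using transitive_classesD(1)[OF tc uv(1,2)] s'[OF uv(1,2)] uv(3,4) by simp
      also have "\<dots> = arc_sign (L_tournament 6) p q"
        using b2 pq by (simp add: L6_labelling_def)
      also have "\<dots> = 1" using x by (simp add: arc_sign_eq_1_iff)
      finally show ?thesis by (simp add: arc_sign_eq_1_iff)
    qed
    then show "case x of (p, q) \<Rightarrow> P p \<times> P q \<subseteq> parcs T'" using x by auto
  qed (rule T'(1), rule refl)
  \<comment> \<open>Each block contains its own representative.\<close>
  moreover have "0 < card (P p)" if "p \<in> {1..6}" for p
  proof -
    have "b p \<in> P p" using that bV tb.rep_base[of "b p"] by (auto simp: P_def)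
    moreover have "finite (P p)" using finite_V by (simp add: P_def)
    ultimately show ?thesis by (auto simp: card_gt_0_iff)
  qed
  moreover have "switching_equivalent T T'"
    unfolding switching_equivalent_def T'_def by (intro disjI1 exI[of _ W]) (auto simp: W_def)
  ultimately show ?thesis
    unfolding pverts_L_tournament by (intro exI[of _ T'] exI[of _ "\<lambda>p. card (P p)"] conjI ballI)
qed

theorem theorem3p11:
  fixes T :: "'a pair_pre_digraph"
  assumes "tournament T"
  shows "T \<in> D_class 5 - D_class 3 \<longleftrightarrow>
    (\<exists>T' a. (\<forall>v\<in>pverts (L_tournament 6). 0 < a v) \<and>
            is_transitive_blowup (L_tournament 6) a T' \<and> switching_equivalent T T')"
proof -
  have "T \<in> D_class 5 - D_class 3 \<longleftrightarrow>
      minors_le 25 (pverts T) (arc_sign T) \<and> \<not> minors_le 9 (pverts T) (arc_sign T)"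
    using D_class_iff_minors_le[OF assms, of 5] D_class_iff_minors_le[OF assms, of 3] by simp
  \<comment> \<open>Switching preserves all minors, so the bounds for \<open>T'\<close> carry over
    to \<open>T\<close>.\<close>
  moreover have "minors_le 25 (pverts T) (arc_sign T) \<and> \<not> minors_le 9 (pverts T) (arc_sign T)"
    if "\<forall>v\<in>pverts (L_tournament 6). 0 < a v" "is_transitive_blowup (L_tournament 6) a T'" "switching_equivalent T T'"
    for T' :: "'a pair_pre_digraph" and a
    using blowup_L6_minors[OF that(1,2)] switching_equivalent_minors_le[OF assms _ that(3)] that(2)
    by (simp add: is_transitive_blowup_def)
  ultimately show ?thesis using ex_blowup_L6[OF assms] by blast
qed

end
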